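(* Let $(\rho_V,V)$ and $(\rho_W,W)$ be two finite-dimensional complex representations of a finite group $G$. Let $\psi:G\to\mathrm{Hom}(V,W)$ be an equivariant filter. Then there exist invertible matrices $Q_{in}\in M_{\dim(V)}(\mathbb{C})$ and $Q_{out}\in M_{\dim(W)}(\mathbb{C})$ such that for all $g\in G$ $$\kappa(g)=Q_{out}^{-1}\,\psi(g)\,Q_{in}$$ is a block matrix, with blocks $\kappa_{ji}(g)$, in which $\kappa_{ji}(g)=0$ when $i\neq j$ and $$\kappa_{ii}(g)=A^{(i)}(g)\otimes I_{d_i},$$ where $A^{(i)}(g)$ is a matrix and $d_i$ is a positive integer which are determined by the decompositions of $V$ and $W$ into the direct sums of irreducible subrepresentations.
   Context: $\mathrm{Hom}(V,W)$ is the space of linear maps $V\to W$, and $\psi(g)$ is regarded as a $\dim(W)\times\dim(V)$ complex matrix. An equivariant filter is a function $\psi:G\to\mathrm{Hom}(V,W)$ satisfying $\psi(x)\rho_V(u)=\rho_W(u)\psi(x)$ for all $x,u\in G$. Let $(\mu_1,V_1),\dots,(\mu_r,V_r)$ be the full list of pairwise non-isomorphic irreducible representations of $G$. By Maschke's theorem, collecting isomorphic irreducible representations together, $V=\bigoplus_{i\in I}V_i^{\oplus m_i}$ and $W=\bigoplus_{j\in J}V_j^{\oplus n_j}$, where $I,J\subseteq\{1,\dots,r\}$ and $m_i,n_j$ are positive integer multiplicities. In the block $\kappa_{ji}(g)$ the row index $j$ runs over $J$ and the column index $i$ runs over $I$ (so $\kappa_{ii}(g)$ occurs for $i\in I\cap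 J$). $I_d$ is the $d\times d$ identity matrix, $\otimes$ is the Kronecker product of matrices, and $M_n(\mathbb{C})$ is the set of $n\times n$ complex matrices. *)

theory Defs
  imports
    Complex_Main
    "Jordan_Normal_Form.VS_Connect"
    "Jordan_Normal_Form.DL_Submatrix"
begin

text \<open>Complex vector spaces are \<open>vectorspace\<close> structures over the field record
  \<open>class_ring\<close> of type \<open>complex\<close>; maps are constrained only on the carriers.\<close>

definition fin_dim_rep ::
  "('g, 'x) monoid_scheme \<Rightarrow> (complex, 'v) module \<Rightarrow> ('g \<Rightarrow> 'v \<Rightarrow> 'v) \<Rightarrow> bool" where
  "fin_dim_rep G V \<rho> \<longleftrightarrow>
     vectorspace class_ring V \<and> vectorspace.fin_dim class_ring V \<and>
     (\<forall>g\<in>carrier G. linear_map class_ring V V (\<rho> g)) \<and>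
     (\<forall>v\<in>carrier V. \<rho> \<one>\<^bsub>G\<^esub> v = v) \<and>
     (\<forall>g\<in>carrier G. \<forall>h\<in>carrier G. \<forall>v\<in>carrier V. \<rho> (g \<otimes>\<^bsub>G\<^esub> h) v = \<rho> g (\<rho> h v))"

definition invariant_subspace ::
  "('g, 'x) monoid_scheme \<Rightarrow> (complex, 'v) module \<Rightarrow> ('g \<Rightarrow> 'v \<Rightarrow> 'v) \<Rightarrow> 'v set \<Rightarrow> bool" where
  "invariant_subspace G V \<rho> U \<longleftrightarrow>
     VectorSpace.subspace class_ring U V \<and> (\<forall>g\<in>carrier G. \<rho> g ` U \<subseteq> U)"

definition irreducible_rep ::
  "('g, 'x) monoid_scheme \<Rightarrow> (complex, 'v) module \<Rightarrow> ('g \<Rightarrow> 'v \<Rightarrow> 'v) \<Rightarrow> bool" where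
  "irreducible_rep G V \<rho> \<longleftrightarrow>
     fin_dim_rep G V \<rho> \<and> carrier V \<noteq> {\<zero>\<^bsub>V\<^esub>} \<and>
     (\<forall>U. invariant_subspace G V \<rho> U \<longrightarrow> U = {\<zero>\<^bsub>V\<^esub>} \<or> U = carrier V)"

definition isomorphic_reps ::
  "('g, 'x) monoid_scheme \<Rightarrow> (complex, 'v) module \<Rightarrow> ('g \<Rightarrow> 'v \<Rightarrow> 'v) \<Rightarrow>
   (complex, 'w) module \<Rightarrow> ('g \<Rightarrow> 'w \<Rightarrow> 'w) \<Rightarrow> bool" where
  "isomorphic_reps G V \<rho> W \<sigma> \<longleftrightarrow>
     (\<exists>T. linear_map class_ring V W T \<and> bij_betw T (carrier V) (carrier W) \<and>
          (\<forall>g\<in>carrier G. \<forall>v\<in>carrier V. T (\<rho> g v) = \<sigma> g (T v)))"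

text \<open>Completeness of the list is tested on representations carried by some
  $\mathbb{C}^d$: one cannot quantify over all types inside a formula, and every
  finite-dimensional complex representation is isomorphic to one of this form.\<close>

definition full_irrep_list ::
  "('g, 'x) monoid_scheme \<Rightarrow> nat \<Rightarrow> (nat \<Rightarrow> (complex, 'u) module) \<Rightarrow>
   (nat \<Rightarrow> 'g \<Rightarrow> 'u \<Rightarrow> 'u) \<Rightarrow> bool" where
  "full_irrep_list G r Vs \<mu> \<longleftrightarrow>
     (\<forall>i\<in>{1..r}. irreducible_rep G (Vs i) (\<mu> i)) \<and>
     (\<forall>i\<in>{1..r}. \<forall>j\<in>{1..r}. i \<noteq> j \<longrightarrow> \<not> isomorphic_reps G (Vs i) (\<mu> i) (Vs j) (\<mu> j)) \<and>
     (\<forall>d \<sigma>. irreducible_rep G (module_vec TYPE(complex) d) \<sigma> \<longrightarrow>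
        (\<exists>i\<in>{1..r}. isomorphic_reps G (module_vec TYPE(complex) d) \<sigma> (Vs i) (\<mu> i)))"

definition internal_direct_sum :: "(complex, 'v) module \<Rightarrow> 'p set \<Rightarrow> ('p \<Rightarrow> 'v set) \<Rightarrow> bool" where
  "internal_direct_sum V P U \<longleftrightarrow>
     (\<forall>p\<in>P. VectorSpace.subspace class_ring (U p) V) \<and>
     (\<forall>v\<in>carrier V. \<exists>!f. f \<in> (\<Pi>\<^sub>E p\<in>P. U p) \<and> v = (\<Oplus>\<^bsub>V\<^esub>p\<in>P. f p))"

text \<open>$V = \bigoplus_{i \in I} V_i^{\oplus m_i}$: the subrepresentations \<open>U (i, k)\<close>,
  for \<open>k\<close> in \<open>{1..m i}\<close>, are the \<open>m i\<close> copies of \<open>V\<^sub>i\<close> inside \<open>V\<close>.\<close>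

definition irrep_decomposition ::
  "('g, 'x) monoid_scheme \<Rightarrow> nat \<Rightarrow> (nat \<Rightarrow> (complex, 'u) module) \<Rightarrow>
   (nat \<Rightarrow> 'g \<Rightarrow> 'u \<Rightarrow> 'u) \<Rightarrow> (complex, 'v) module \<Rightarrow> ('g \<Rightarrow> 'v \<Rightarrow> 'v) \<Rightarrow>
   nat set \<Rightarrow> (nat \<Rightarrow> nat) \<Rightarrow> bool" where
  "irrep_decomposition G r Vs \<mu> V \<rho> I m \<longleftrightarrow>
     I \<subseteq> {1..r} \<and> (\<forall>i\<in>I. 0 < m i) \<and>
     (\<exists>U. internal_direct_sum V (SIGMA i:I. {1..m i}) U \<and>
          (\<forall>i\<in>I. \<forall>k\<in>{1..m i}.
             invariant_subspace G V \<rho> (U (i, k)) \<and>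
             isomorphic_reps G (V\<lparr>carrier := U (i, k)\<rparr>) \<rho> (Vs i) (\<mu> i)))"

definition equivariant_filter ::
  "('g, 'x) monoid_scheme \<Rightarrow> (complex, 'v) module \<Rightarrow> ('g \<Rightarrow> 'v \<Rightarrow> 'v) \<Rightarrow>
   (complex, 'w) module \<Rightarrow> ('g \<Rightarrow> 'w \<Rightarrow> 'w) \<Rightarrow> ('g \<Rightarrow> 'v \<Rightarrow> 'w) \<Rightarrow> bool" where
  "equivariant_filter G V \<rho>V W \<rho>W \<psi> \<longleftrightarrow>
     (\<forall>x\<in>carrier G. linear_map class_ring V W (\<psi> x)) \<and>
     (\<forall>x\<in>carrier G. \<forall>u\<in>carrier G. \<forall>v\<in>carrier V. \<psi> x (\<rho>V u v) = \<rho>W u (\<psi> x v))"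

definition ordered_basis :: "(complex, 'v) module \<Rightarrow> 'v list \<Rightarrow> bool" where
  "ordered_basis V bs \<longleftrightarrow> distinct bs \<and> vectorspace.basis class_ring V (set bs)"

text \<open>\<open>M\<close> is the matrix of \<open>T\<close> from the ordered basis \<open>bs\<close> to the ordered basis \<open>cs\<close>
  of \<open>W\<close> (column convention).\<close>

definition is_matrix_of ::
  "'v list \<Rightarrow> (complex, 'w) module \<Rightarrow> 'w list \<Rightarrow> ('v \<Rightarrow> 'w) \<Rightarrow> complex mat \<Rightarrow> bool" where
  "is_matrix_of bs W cs T M \<longleftrightarrow>
     M \<in> carrier_mat (length cs) (length bs) \<and>
     (\<forall>j<length bs. T (bs ! j) = (\<Oplus>\<^bsub>W\<^esub>i\<in>{..<length cs}. M $$ (i, j) \<odot>\<^bsub>W\<^esub> cs ! i))"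

definition kronecker_product :: "'a::times mat \<Rightarrow> 'a mat \<Rightarrow> 'a mat" where
  "kronecker_product A B =
     mat (dim_row A * dim_row B) (dim_col A * dim_col B)
       (\<lambda>(i, j). A $$ (i div dim_row B, j div dim_col B) * B $$ (i mod dim_row B, j mod dim_col B))"

text \<open>A range of consecutive indices, starting from 0, is partitioned into segments, one
  for each \<open>s \<in> S\<close> in increasing order; the segment for \<open>s\<close> has length \<open>len s\<close>.\<close>

definition segment :: "nat set \<Rightarrow> (nat \<Rightarrow> nat) \<Rightarrow> nat \<Rightarrow> nat set" where
  "segment S len s = (let a = (\<Sum>t | t \<in> S \<and> t < s. len t) in {a..<a + len s})"

text \<open>With block heights \<open>hts\<close> and block widths \<open>wds\<close>: the block in block row \<open>j \<in> J\<close> and block column \<open>i \<in> I\<close>.\<close>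

definition block ::
  "nat set \<Rightarrow> (nat \<Rightarrow> nat) \<Rightarrow> nat set \<Rightarrow> (nat \<Rightarrow> nat) \<Rightarrow> 'a mat \<Rightarrow> nat \<Rightarrow> nat \<Rightarrow> 'a mat" where
  "block J hts I wds M j i = submatrix M (segment J hts j) (segment I wds i)"

end

theory Submission
  imports Defs "Jordan_Normal_Form.Spectral_Radius"
begin

text \<open>For every \<open>g\<close> the map \<open>\<psi> g\<close> intertwines the two representations. By Maschke's theorem
  choose bases of \<open>V\<close> and \<open>W\<close> adapted to decompositions into irreducible subrepresentations,
  carrying one fixed basis of each \<open>V\<^sub>i\<close> to all of its copies. The component of \<open>\<psi> g\<close> from a copy of
  \<open>V\<^sub>i\<close> to a copy of \<open>V\<^sub>j\<close> is then, by Schur's lemma, zero if \<open>i \<noteq> j\<close> and a scalar multiple of the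
  identity matrix if \<open>i = j\<close>; these scalars, one for each pair of copies, form the matrix
  \<open>A\<^sup>(\<^sup>i\<^sup>) g\<close>.\<close>

section \<open>Vector spaces and linear maps\<close>

text \<open>Schur's lemma is applied only to maps between the listed \<open>Vs i\<close> themselves.
  \<open>V\<close> and \<open>W\<close> live on different types, so a copy of
  \<open>V\<^sub>i\<close> inside \<open>V\<close> is handled as an intertwiner
  \<open>\<iota> p\<close> from \<open>Vs i\<close> into \<open>V\<close>, and a copy of
  \<open>V\<^sub>j\<close> inside \<open>W\<close> as an intertwiner \<open>\<pi> p\<close> from
  \<open>W\<close> onto \<open>Vs j\<close>; the composite of \<open>\<iota>\<close>,
  \<open>\<psi> g\<close> and \<open>\<pi>\<close> then goes from \<open>Vs i\<close> to
  \<open>Vs j\<close>. The integer d_i of the statement is the dimension of \<open>Vs i\<close>.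

  The adapted bases start from an arbitrary given decomposition, so averaging over the group serves
  only to show that decompositions exist. Completeness of the list of irreducible representations is
  tested on the spaces of complex vectors alone, which forces every irreducible summand to be
  transported there by coordinates before it can be matched with an entry of the list.

  The columns of \<open>Qin\<close> and \<open>Qout\<close> are the adapted basis vectors written in
  the given bases. These matrices, their inverses and \<open>\<kappa>\<close> are all coordinate
  matrices, and one multiplication law accounts for every product among them.\<close>

locale complex_vectorspace = vectorspace "class_ring :: complex ring" V
  for V :: "(complex, 'v) module"
begin

lemma smult_in [simp]: "v \<in> carrier V \<Longrightarrow> a \<odot>\<^bsub>V\<^esub> v \<in> carrier V"
  by simp

text \<open>Over \<open>class_ring\<close> every complex number is a scalar and the ring operations
  are the usual ones, so here and below the module laws lose their carrier conditions on
  scalars.\<close>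

lemma smult_add_left: "v \<in> carrier V \<Longrightarrow> (a + b) \<odot>\<^bsub>V\<^esub> v = a \<odot>\<^bsub>V\<^esub> v \<oplus>\<^bsub>V\<^esub> b \<odot>\<^bsub>V\<^esub> v"
  using smult_l_distr[of a b v] by simp

lemma smult_add_right:
  "v \<in> carrier V \<Longrightarrow> w \<in> carrier V \<Longrightarrow> a \<odot>\<^bsub>V\<^esub> (v \<oplus>\<^bsub>V\<^esub> w) = a \<odot>\<^bsub>V\<^esub> v \<oplus>\<^bsub>V\<^esub> a \<odot>\<^bsub>V\<^esub> w"
  using smult_r_distr[of a v w] by simp

lemma smult_smult: "v \<in> carrier V \<Longrightarrow> a \<odot>\<^bsub>V\<^esub> (b \<odot>\<^bsub>V\<^esub> v) = (a * b) \<odot>\<^bsub>V\<^esub> v"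
  using smult_assoc1[of a b v] by simp

lemma one_smult [simp]: "v \<in> carrier V \<Longrightarrow> 1 \<odot>\<^bsub>V\<^esub> v = v"
  using smult_one[of v] by simp

lemma zero_smult [simp]: "v \<in> carrier V \<Longrightarrow> 0 \<odot>\<^bsub>V\<^esub> v = \<zero>\<^bsub>V\<^esub>"
  using lmult_0[of v] by simp

lemma smult_zero [simp]: "a \<odot>\<^bsub>V\<^esub> \<zero>\<^bsub>V\<^esub> = \<zero>\<^bsub>V\<^esub>"
  using rmult_0[of a] by simp

lemma minus_one_smult: "v \<in> carrier V \<Longrightarrow> (- 1) \<odot>\<^bsub>V\<^esub> v = \<ominus>\<^bsub>V\<^esub> v"
  using smult_minus_1[of v] by (simp add: class_ring_simps)

lemma smult_finsum:
  "f \<in> A \<rightarrow> carrier V \<Longrightarrow> c \<odot>\<^bsub>V\<^esub> (\<Oplus>\<^bsub>V\<^esub>a\<in>A. f a) = (\<Oplus>\<^bsub>V\<^esub>a\<in>A. c \<odot>\<^bsub>V\<^esub> f a)"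
  using finsum_smult[of c f A] by simp

lemma sum_smult:
  "v \<in> carrier V \<Longrightarrow> (\<Sum>a\<in>A. f a) \<odot>\<^bsub>V\<^esub> v = (\<Oplus>\<^bsub>V\<^esub>a\<in>A. f a \<odot>\<^bsub>V\<^esub> v)"
  using finsum_smult_r[of v f A] by (simp add: class_ring_simps)

lemma finsum_delta:
  assumes "finite A" "i \<in> A" "x \<in> carrier V"
  shows "(\<Oplus>\<^bsub>V\<^esub>a\<in>A. if a = i then x else \<zero>\<^bsub>V\<^esub>) = x"
  using assms add.finprod_singleton_swap[of i A "\<lambda>_. x"] by auto

lemma finsum_Sigma:
  assumes "finite A" "\<And>a. a \<in> A \<Longrightarrow> finite (B a)"
    and "\<And>a b. a \<in> A \<Longrightarrow> b \<in> B a \<Longrightarrow> f a b \<in> carrier V"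
  shows "(\<Oplus>\<^bsub>V\<^esub>p\<in>Sigma A B. f (fst p) (snd p)) = (\<Oplus>\<^bsub>V\<^esub>a\<in>A. \<Oplus>\<^bsub>V\<^esub>b\<in>B a. f a b)"
  using assms
proof (induction A rule: finite_induct)
  case (insert x A)
  have S: "Sigma (insert x A) B = Pair x ` B x \<union> Sigma A B" by auto
  have disj: "Pair x ` B x \<inter> Sigma A B = {}" using insert by auto
  have "(\<Oplus>\<^bsub>V\<^esub>p\<in>Sigma (insert x A) B. f (fst p) (snd p)) =
      (\<Oplus>\<^bsub>V\<^esub>p\<in>Pair x ` B x. f (fst p) (snd p)) \<oplus>\<^bsub>V\<^esub> (\<Oplus>\<^bsub>V\<^esub>p\<in>Sigma A B. f (fst p) (snd p))"
    unfolding S using insert.prems insert.hyps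
    by (intro finsum_Un_disjoint disj) auto
  also have "(\<Oplus>\<^bsub>V\<^esub>p\<in>Pair x ` B x. f (fst p) (snd p)) = (\<Oplus>\<^bsub>V\<^esub>b\<in>B x. f x b)"
    using insert.prems by (subst finsum_reindex) (auto simp: inj_on_def)
  also have "(\<Oplus>\<^bsub>V\<^esub>p\<in>Sigma A B. f (fst p) (snd p)) = (\<Oplus>\<^bsub>V\<^esub>a\<in>A. \<Oplus>\<^bsub>V\<^esub>b\<in>B a. f a b)"
    using insert by auto
  finally show ?case
    using insert by (subst finsum_insert) auto
qed auto

lemma subspaceI:
  assumes "U \<subseteq> carrier V" "\<zero>\<^bsub>V\<^esub> \<in> U"
    and "\<And>v w. v \<in> U \<Longrightarrow> w \<in> U \<Longrightarrow> v \<oplus>\<^bsub>V\<^esub> w \<in> U" "\<And>a v. v \<in> U \<Longrightarrow> a \<odot>\<^bsub>V\<^esub> v \<in> U"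
  shows "VectorSpace.subspace class_ring U V"
  using assms module_axioms vectorspace_axioms
  by (simp add: VectorSpace.subspace_def submodule_def)

lemma subspaceD:
  assumes "VectorSpace.subspace class_ring U V"
  shows "U \<subseteq> carrier V" "\<zero>\<^bsub>V\<^esub> \<in> U"
    and "\<And>v w. v \<in> U \<Longrightarrow> w \<in> U \<Longrightarrow> v \<oplus>\<^bsub>V\<^esub> w \<in> U" "\<And>a v. v \<in> U \<Longrightarrow> a \<odot>\<^bsub>V\<^esub> v \<in> U"
  using assms by (simp_all add: VectorSpace.subspace_def submodule_def)

lemma subspace_finsum:
  assumes U: "VectorSpace.subspace class_ring U V" and f: "f \<in> A \<rightarrow> U"
  shows "(\<Oplus>\<^bsub>V\<^esub>a\<in>A. f a) \<in> U"
  using f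
\<comment> \<open>A sum over an infinite set is zero by convention, and zero lies in
  \<open>U\<close>.\<close>
proof (induction A rule: infinite_finite_induct)
  case (insert x A)
  then have "f \<in> insert x A \<rightarrow> carrier V" using subspaceD(1)[OF U] by auto
  then show ?case using insert subspaceD[OF U] by (subst finsum_insert) auto
qed (use subspaceD[OF U] in auto)

text \<open>The definition of a finite sum refers to the carrier of the structure, so shrinking the
  carrier changes the term; its value is compared by induction.\<close>

lemma finsum_subspace:
  assumes U: "VectorSpace.subspace class_ring U V" and "finite A" "f \<in> A \<rightarrow> U"
  shows "(\<Oplus>\<^bsub>V\<lparr>carrier := U\<rparr>\<^esub>a\<in>A. f a) = (\<Oplus>\<^bsub>V\<^esub>a\<in>A. f a)"
  using assms(2,3)
proof (induction A rule: finite_induct)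
  case empty
  interpret U: vectorspace class_ring "V\<lparr>carrier := U\<rparr>" by (rule subspace_is_vs[OF U])
  show ?case by simp
next
  case (insert x A)
  interpret U: vectorspace class_ring "V\<lparr>carrier := U\<rparr>" by (rule subspace_is_vs[OF U])
  have "f \<in> insert x A \<rightarrow> carrier V" using insert subspaceD(1)[OF U] by auto
  with insert show ?case
    by (subst U.finsum_insert) (auto simp: finsum_insert)
qed

end

section \<open>Closure properties of linear maps\<close>

lemma complex_vectorspaceI: "vectorspace class_ring V \<Longrightarrow> complex_vectorspace V"
  by (simp add: complex_vectorspace_def)

lemma linear_mapI:
  fixes V :: "(complex, 'v) module" and W :: "(complex, 'w) module"
  assumes "vectorspace class_ring V" "vectorspace class_ring W"
    and "\<And>v. v \<in> carrier V \<Longrightarrow> T v \<in> carrier W"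
    and "\<And>v w. v \<in> carrier V \<Longrightarrow> w \<in> carrier V \<Longrightarrow> T (v \<oplus>\<^bsub>V\<^esub> w) = T v \<oplus>\<^bsub>W\<^esub> T w"
    and "\<And>a v. v \<in> carrier V \<Longrightarrow> T (a \<odot>\<^bsub>V\<^esub> v) = a \<odot>\<^bsub>W\<^esub> T v"
  shows "linear_map class_ring V W T"
  using assms
  by (auto simp: linear_map_def mod_hom_def mod_hom_axioms_def LinearCombinations.module_hom_def vectorspace_def)

lemma linear_mapD:
  fixes V :: "(complex, 'v) module" and W :: "(complex, 'w) module"
  assumes "linear_map class_ring V W T"
  shows "vectorspace class_ring V" "vectorspace class_ring W"
    and "\<And>v. v \<in> carrier V \<Longrightarrow> T v \<in> carrier W"
    and "\<And>v w. v \<in> carrier V \<Longrightarrow> w \<in> carrier V \<Longrightarrow> T (v \<oplus>\<^bsub>V\<^esub> w) = T v \<oplus>\<^bsub>W\<^esub> T w"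
    and "\<And>a v. v \<in> carrier V \<Longrightarrow> T (a \<odot>\<^bsub>V\<^esub> v) = a \<odot>\<^bsub>W\<^esub> T v"
    and "T \<zero>\<^bsub>V\<^esub> = \<zero>\<^bsub>W\<^esub>"
    and "\<And>A f. f \<in> A \<rightarrow> carrier V \<Longrightarrow> T (\<Oplus>\<^bsub>V\<^esub>a\<in>A. f a) = (\<Oplus>\<^bsub>W\<^esub>a\<in>A. T (f a))"
proof -
  interpret linear_map class_ring V W T by fact
  show "vectorspace class_ring V" "vectorspace class_ring W"
    by (rule V.vectorspace_axioms, rule W.vectorspace_axioms)
  show "\<And>v. v \<in> carrier V \<Longrightarrow> T v \<in> carrier W"
    "\<And>v w. v \<in> carrier V \<Longrightarrow> w \<in> carrier V \<Longrightarrow> T (v \<oplus>\<^bsub>V\<^esub> w) = T v \<oplus>\<^bsub>W\<^esub> T w"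
    "\<And>a v. v \<in> carrier V \<Longrightarrow> T (a \<odot>\<^bsub>V\<^esub> v) = a \<odot>\<^bsub>W\<^esub> T v"
    "T \<zero>\<^bsub>V\<^esub> = \<zero>\<^bsub>W\<^esub>" by simp_all
  fix A :: "'c set" and f
  assume "f \<in> A \<rightarrow> carrier V"
  then show "T (\<Oplus>\<^bsub>V\<^esub>a\<in>A. f a) = (\<Oplus>\<^bsub>W\<^esub>a\<in>A. T (f a))"
  proof (induction A rule: infinite_finite_induct)
    case (insert x A)
    then show ?case
      by (subst V.module.M.finsum_insert) (auto simp: W.module.M.finsum_insert Pi_iff)
  qed auto
qed

lemma linear_map_comp:
  fixes V :: "(complex, 'v) module" and W :: "(complex, 'w) module" and X :: "(complex, 'x) module"
  assumes "linear_map class_ring V W T" "linear_map class_ring W X S"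
  shows "linear_map class_ring V X (\<lambda>v. S (T v))"
  using linear_mapD[OF assms(1)] linear_mapD[OF assms(2)] by (intro linear_mapI) auto

lemma linear_map_id:
  fixes V :: "(complex, 'v) module"
  shows "vectorspace class_ring V \<Longrightarrow> linear_map class_ring V V (\<lambda>v. v)"
  by (rule linear_mapI) simp_all

lemma linear_map_restrict:
  fixes V :: "(complex, 'v) module" and W :: "(complex, 'w) module"
  assumes T: "linear_map class_ring V W T" and U: "VectorSpace.subspace class_ring U V"
  shows "linear_map class_ring (V\<lparr>carrier := U\<rparr>) W T"
proof -
  interpret V: complex_vectorspace V
    using linear_mapD(1)[OF T] by (rule complex_vectorspaceI)
  show ?thesis
    using linear_mapD[OF T] V.subspaceD(1)[OF U] V.subspace_is_vs[OF U]
    by (intro linear_mapI) (auto simp: subset_iff)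
qed

lemma linear_map_corestrict:
  fixes V :: "(complex, 'v) module" and W :: "(complex, 'w) module"
  assumes T: "linear_map class_ring V W T" and U: "VectorSpace.subspace class_ring U W"
    and "T ` carrier V \<subseteq> U"
  shows "linear_map class_ring V (W\<lparr>carrier := U\<rparr>) T"
proof -
  interpret W: complex_vectorspace W
    using linear_mapD(2)[OF T] by (rule complex_vectorspaceI)
  show ?thesis
    using linear_mapD[OF T] assms(3) W.subspace_is_vs[OF U]
    by (intro linear_mapI) auto
qed

lemma linear_map_inclusion:
  fixes V :: "(complex, 'v) module"
  assumes "VectorSpace.subspace class_ring U V"
  shows "linear_map class_ring (V\<lparr>carrier := U\<rparr>) V (\<lambda>v. v)"
  using assms by (intro linear_map_restrict linear_map_id) (auto simp: VectorSpace.subspace_def)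

lemma linear_map_cong:
  fixes V :: "(complex, 'v) module" and W :: "(complex, 'w) module"
  assumes T: "linear_map class_ring V W T" and eq: "\<And>v. v \<in> carrier V \<Longrightarrow> T v = S v"
  shows "linear_map class_ring V W S"
proof -
  interpret V: complex_vectorspace V
    using linear_mapD(1)[OF T] by (rule complex_vectorspaceI)
  show ?thesis
    using linear_mapD[OF T] eq[symmetric] by (intro linear_mapI) simp_all
qed

lemma linear_map_inv_into:
  fixes V :: "(complex, 'v) module" and W :: "(complex, 'w) module"
  assumes T: "linear_map class_ring V W T" and bij: "bij_betw T (carrier V) (carrier W)"
  shows "linear_map class_ring W V (inv_into (carrier V) T)"
proof -
  interpret V: complex_vectorspace V
    using linear_mapD(1)[OF T] by (rule complex_vectorspaceI)
  interpret W: complex_vectorspace W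
    using linear_mapD(2)[OF T] by (rule complex_vectorspaceI)
  let ?S = "inv_into (carrier V) T"
  have S: "\<And>w. w \<in> carrier W \<Longrightarrow> ?S w \<in> carrier V \<and> T (?S w) = w"
    using bij by (metis bij_betw_def f_inv_into_f inv_into_into)
  \<comment> \<open>An identity for the inverse map is checked after applying
    \<open>T\<close>.\<close>
  have eqI: "v = ?S w" if "v \<in> carrier V" "T v = w" for v w
    using that bij by (auto simp: bij_betw_def)
  show ?thesis
    using linear_mapD[OF T] S
    by (intro linear_mapI eqI[symmetric]) auto
qed

lemma linear_map_finsum:
  fixes V :: "(complex, 'v) module" and W :: "(complex, 'w) module"
  assumes V: "vectorspace class_ring V" and W: "vectorspace class_ring W"
    and T: "\<And>a. a \<in> A \<Longrightarrow> linear_map class_ring V W (T a)"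
  shows "linear_map class_ring V W (\<lambda>v. \<Oplus>\<^bsub>W\<^esub>a\<in>A. T a v)"
proof -
  interpret V: complex_vectorspace V using V by (rule complex_vectorspaceI)
  interpret W: complex_vectorspace W using W by (rule complex_vectorspaceI)
  note T' = linear_mapD[OF T]
  show ?thesis
  proof (rule linear_mapI[OF V W])
    fix v w assume vw: "v \<in> carrier V" "w \<in> carrier V"
    have "(\<Oplus>\<^bsub>W\<^esub>a\<in>A. T a (v \<oplus>\<^bsub>V\<^esub> w)) = (\<Oplus>\<^bsub>W\<^esub>a\<in>A. T a v \<oplus>\<^bsub>W\<^esub> T a w)"
      using T' vw by (intro W.finsum_cong') auto
    then show "(\<Oplus>\<^bsub>W\<^esub>a\<in>A. T a (v \<oplus>\<^bsub>V\<^esub> w)) = (\<Oplus>\<^bsub>W\<^esub>a\<in>A. T a v) \<oplus>\<^bsub>W\<^esub> (\<Oplus>\<^bsub>W\<^esub>a\<in>A. T a w)"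
      using T' vw by (simp add: W.finsum_addf)
  next
    fix c v assume v: "v \<in> carrier V"
    have "(\<Oplus>\<^bsub>W\<^esub>a\<in>A. T a (c \<odot>\<^bsub>V\<^esub> v)) = (\<Oplus>\<^bsub>W\<^esub>a\<in>A. c \<odot>\<^bsub>W\<^esub> T a v)"
      using T' v by (intro W.finsum_cong') auto
    then show "(\<Oplus>\<^bsub>W\<^esub>a\<in>A. T a (c \<odot>\<^bsub>V\<^esub> v)) = c \<odot>\<^bsub>W\<^esub> (\<Oplus>\<^bsub>W\<^esub>a\<in>A. T a v)"
      using T' v by (simp add: W.smult_finsum)
  qed (use T' in auto)
qed

lemma linear_map_smult:
  fixes V :: "(complex, 'v) module" and W :: "(complex, 'w) module"
  assumes "linear_map class_ring V W T"
  shows "linear_map class_ring V W (\<lambda>v. c \<odot>\<^bsub>W\<^esub> T v)"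
proof -
  interpret W: complex_vectorspace W
    using linear_mapD(2)[OF assms] by (rule complex_vectorspaceI)
  show ?thesis
    using linear_mapD[OF assms]
    by (intro linear_mapI) (auto simp: W.smult_add_right W.smult_smult mult.commute)
qed

lemma linear_map_add:
  fixes V :: "(complex, 'v) module" and W :: "(complex, 'w) module"
  assumes "linear_map class_ring V W T" "linear_map class_ring V W S"
  shows "linear_map class_ring V W (\<lambda>v. T v \<oplus>\<^bsub>W\<^esub> S v)"
proof -
  interpret W: complex_vectorspace W
    using linear_mapD(2)[OF assms(1)] by (rule complex_vectorspaceI)
  show ?thesis
    using linear_mapD[OF assms(1)] linear_mapD[OF assms(2)]
    by (intro linear_mapI) (auto simp: W.smult_add_right W.M.add.m_ac)
qed

section \<open>Coordinates\<close>

text \<open>A finite basis \<open>b\<close> together with its dual basis: \<open>co v k\<close> is the coefficient of \<open>v\<close> at \<open>b k\<close>.\<close>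

locale coordinate_system = complex_vectorspace V
  for V :: "(complex, 'v) module" +
  fixes K :: "'k set" and b :: "'k \<Rightarrow> 'v" and co :: "'v \<Rightarrow> 'k \<Rightarrow> complex"
  assumes finite_index [simp]: "finite K"
    and basis_in [simp]: "k \<in> K \<Longrightarrow> b k \<in> carrier V"
    and co_add: "v \<in> carrier V \<Longrightarrow> w \<in> carrier V \<Longrightarrow> k \<in> K \<Longrightarrow> co (v \<oplus>\<^bsub>V\<^esub> w) k = co v k + co w k"
    and co_smult: "v \<in> carrier V \<Longrightarrow> k \<in> K \<Longrightarrow> co (a \<odot>\<^bsub>V\<^esub> v) k = a * co v k"
    and expansion: "v \<in> carrier V \<Longrightarrow> (\<Oplus>\<^bsub>V\<^esub>k\<in>K. co v k \<odot>\<^bsub>V\<^esub> b k) = v"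
    and co_basis: "j \<in> K \<Longrightarrow> k \<in> K \<Longrightarrow> co (b j) k = (if j = k then 1 else 0)"
begin

lemma co_zero: "k \<in> K \<Longrightarrow> co \<zero>\<^bsub>V\<^esub> k = 0"
  using co_smult[of "\<zero>\<^bsub>V\<^esub>" k 0] by simp

lemma co_finsum:
  assumes "f \<in> A \<rightarrow> carrier V" "k \<in> K"
  shows "co (\<Oplus>\<^bsub>V\<^esub>a\<in>A. f a) k = (\<Sum>a\<in>A. co (f a) k)"
  using assms
proof (induction A rule: infinite_finite_induct)
  case (insert x A)
  then show ?case by (subst finsum_insert) (auto simp: co_add)
qed (simp_all add: co_zero)

lemma co_lincomb:
  assumes "k \<in> K"
  shows "co (\<Oplus>\<^bsub>V\<^esub>j\<in>K. c j \<odot>\<^bsub>V\<^esub> b j) k = c k"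
proof -
  have "co (\<Oplus>\<^bsub>V\<^esub>j\<in>K. c j \<odot>\<^bsub>V\<^esub> b j) k = (\<Sum>j\<in>K. co (c j \<odot>\<^bsub>V\<^esub> b j) k)"
    using assms by (intro co_finsum) auto
  also have "\<dots> = (\<Sum>j\<in>K. if j = k then c k else 0)"
    using assms by (intro sum.cong) (auto simp: co_smult co_basis)
  also have "\<dots> = c k"
    using assms by simp
  finally show ?thesis .
qed

lemma coordinates_eqI:
  assumes "v \<in> carrier V" "w \<in> carrier V" "\<And>k. k \<in> K \<Longrightarrow> co v k = co w k"
  shows "v = w"
proof -
  have "v = (\<Oplus>\<^bsub>V\<^esub>k\<in>K. co v k \<odot>\<^bsub>V\<^esub> b k)" using assms by (simp add: expansion)
  also have "\<dots> = (\<Oplus>\<^bsub>V\<^esub>k\<in>K. co w k \<odot>\<^bsub>V\<^esub> b k)" using assms by (intro finsum_cong') auto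
  also have "\<dots> = w" using assms by (simp add: expansion)
  finally show ?thesis .
qed

lemma inj_on_basis: "inj_on b K"
  by (rule inj_onI) (metis co_basis zero_neq_one)

lemma basis_image: "basis (b ` K)"
proof (subst basis_criterion)
  show "\<forall>v. v \<in> carrier V \<longrightarrow>
    (\<exists>!a. a \<in> b ` K \<rightarrow>\<^sub>E carrier class_ring \<and> lincomb a (b ` K) = v)"
  proof (intro allI impI)
    fix v assume v: "v \<in> carrier V"
    have lc: "lincomb a (b ` K) = (\<Oplus>\<^bsub>V\<^esub>k\<in>K. a (b k) \<odot>\<^bsub>V\<^esub> b k)" for a
      unfolding lincomb_def by (rule finsum_reindex) (auto simp: inj_on_basis)
    \<comment> \<open>The basis criterion asks for a unique extensional coefficient function on the
      basis vectors, hence the restriction; \<open>inv_into\<close> recovers the index from the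
      vector.\<close>
    let ?a = "restrict (\<lambda>x. co v (inv_into K b x)) (b ` K)"
    show "\<exists>!a. a \<in> b ` K \<rightarrow>\<^sub>E carrier class_ring \<and> lincomb a (b ` K) = v"
    proof (rule ex1I[of _ ?a])
      have "(\<Oplus>\<^bsub>V\<^esub>k\<in>K. ?a (b k) \<odot>\<^bsub>V\<^esub> b k) = (\<Oplus>\<^bsub>V\<^esub>k\<in>K. co v k \<odot>\<^bsub>V\<^esub> b k)"
        using inj_on_basis by (intro finsum_cong') auto
      then show "?a \<in> b ` K \<rightarrow>\<^sub>E carrier class_ring \<and> lincomb ?a (b ` K) = v"
        using v by (auto simp: lc expansion)
    next
      fix a assume a: "a \<in> b ` K \<rightarrow>\<^sub>E carrier class_ring \<and> lincomb a (b ` K) = v"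
      have "a (b k) = co v k" if "k \<in> K" for k
        using a co_lincomb[OF that, of "\<lambda>k. a (b k)"] by (simp add: lc)
      with a show "a = ?a"
        using inj_on_basis by (intro ext) (auto simp: PiE_def extensional_def)
    qed
  qed
qed auto

lemma dim_eq_card: "dim = card K"
  using dim_basis[OF _ basis_image] card_image[OF inj_on_basis] by simp

text \<open>Bases arise indexed by pairs or by their own elements, whereas matrices need the indices
  \<open>{..<n}\<close>; this lemma renumbers them.\<close>

lemma reindex:
  assumes "bij_betw h K' K"
  shows "coordinate_system V K' (\<lambda>k. b (h k)) (\<lambda>v k. co v (h k))"
proof
  show "finite K'" using assms bij_betw_finite finite_index by blast
next
  fix v assume v: "v \<in> carrier V"
  have "(\<Oplus>\<^bsub>V\<^esub>k\<in>K'. co v (h k) \<odot>\<^bsub>V\<^esub> b (h k)) = (\<Oplus>\<^bsub>V\<^esub>k\<in>h ` K'. co v k \<odot>\<^bsub>V\<^esub> b k)"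
    using assms by (subst finsum_reindex) (auto simp: bij_betw_def)
  then show "(\<Oplus>\<^bsub>V\<^esub>k\<in>K'. co v (h k) \<odot>\<^bsub>V\<^esub> b (h k)) = v"
    using assms v expansion by (simp add: bij_betw_def)
qed (use assms in \<open>auto simp: bij_betw_def inj_on_def co_add co_smult co_basis\<close>)

lemma linear_extension:
  fixes W :: "(complex, 'w) module"
  assumes W: "vectorspace class_ring W" and f: "f \<in> K \<rightarrow> carrier W"
  shows "linear_map class_ring V W (\<lambda>v. \<Oplus>\<^bsub>W\<^esub>k\<in>K. co v k \<odot>\<^bsub>W\<^esub> f k)"
    and "j \<in> K \<Longrightarrow> (\<Oplus>\<^bsub>W\<^esub>k\<in>K. co (b j) k \<odot>\<^bsub>W\<^esub> f k) = f j"
proof -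
  interpret W: complex_vectorspace W using W by (rule complex_vectorspaceI)
  show "linear_map class_ring V W (\<lambda>v. \<Oplus>\<^bsub>W\<^esub>k\<in>K. co v k \<odot>\<^bsub>W\<^esub> f k)"
    using f vectorspace_axioms W
    by (intro linear_map_finsum linear_mapI)
      (auto simp: co_add co_smult W.smult_add_left W.smult_smult Pi_iff)
  assume j: "j \<in> K"
  have "(\<Oplus>\<^bsub>W\<^esub>k\<in>K. co (b j) k \<odot>\<^bsub>W\<^esub> f k) = (\<Oplus>\<^bsub>W\<^esub>k\<in>K. if k = j then f j else \<zero>\<^bsub>W\<^esub>)"
    using j f by (intro W.finsum_cong') (auto simp: co_basis Pi_iff)
  then show "(\<Oplus>\<^bsub>W\<^esub>k\<in>K. co (b j) k \<odot>\<^bsub>W\<^esub> f k) = f j"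
    using j f by (simp add: W.finsum_delta Pi_iff)
qed

end

section \<open>Existence of coordinates; dimension and complements of subspaces\<close>

context complex_vectorspace
begin

text \<open>The coordinates are the unique coefficient function of the basis criterion. Additivity,
  homogeneity and duality then follow from uniqueness, by exhibiting an expansion with the claimed
  coefficients.\<close>

lemma coordinate_system_of_basis:
  assumes fin: "finite B" and B: "basis B"
  shows "\<exists>co. coordinate_system V B (\<lambda>x. x) co"
proof -
  have BV: "B \<subseteq> carrier V" using B by (simp add: basis_def)
  have ex1: "\<exists>!a. a \<in> B \<rightarrow>\<^sub>E UNIV \<and> (\<Oplus>\<^bsub>V\<^esub>x\<in>B. a x \<odot>\<^bsub>V\<^esub> x) = v" if "v \<in> carrier V" for v
    using basis_criterion[OF fin BV] B that by (simp add: lincomb_def)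
  define co where "co v = (THE a. a \<in> B \<rightarrow>\<^sub>E UNIV \<and> (\<Oplus>\<^bsub>V\<^esub>x\<in>B. a x \<odot>\<^bsub>V\<^esub> x) = v)" for v
  have co: "(\<Oplus>\<^bsub>V\<^esub>x\<in>B. co v x \<odot>\<^bsub>V\<^esub> x) = v" if "v \<in> carrier V" for v
    using theI'[OF ex1[OF that]] by (simp add: co_def)
  have unique: "co v k = a k" if "v \<in> carrier V" "(\<Oplus>\<^bsub>V\<^esub>x\<in>B. a x \<odot>\<^bsub>V\<^esub> x) = v" "k \<in> B" for a v k
  proof -
    have "(\<Oplus>\<^bsub>V\<^esub>x\<in>B. restrict a B x \<odot>\<^bsub>V\<^esub> x) = (\<Oplus>\<^bsub>V\<^esub>x\<in>B. a x \<odot>\<^bsub>V\<^esub> x)"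
      using BV by (intro finsum_cong') auto
    then have "co v = restrict a B"
      unfolding co_def using that by (intro the1_equality ex1) auto
    then show ?thesis using that by simp
  qed
  have in_V: "k \<in> B \<Longrightarrow> k \<in> carrier V" for k using BV by blast
  have "coordinate_system V B (\<lambda>x. x) co"
  proof
    fix v w k assume v: "v \<in> carrier V" "w \<in> carrier V" and k: "k \<in> B"
    have "(\<Oplus>\<^bsub>V\<^esub>x\<in>B. (co v x + co w x) \<odot>\<^bsub>V\<^esub> x) =
        (\<Oplus>\<^bsub>V\<^esub>x\<in>B. co v x \<odot>\<^bsub>V\<^esub> x \<oplus>\<^bsub>V\<^esub> co w x \<odot>\<^bsub>V\<^esub> x)"
      using in_V by (intro finsum_cong') (auto simp: smult_add_left)
    also have "\<dots> = v \<oplus>\<^bsub>V\<^esub> w"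
      using v in_V by (subst finsum_addf) (auto simp: co)
    finally show "co (v \<oplus>\<^bsub>V\<^esub> w) k = co v k + co w k"
      using v k unique[of "v \<oplus>\<^bsub>V\<^esub> w" "\<lambda>x. co v x + co w x"] by simp
  next
    fix v k a assume v: "v \<in> carrier V" and k: "k \<in> B"
    have "(\<Oplus>\<^bsub>V\<^esub>x\<in>B. (a * co v x) \<odot>\<^bsub>V\<^esub> x) = (\<Oplus>\<^bsub>V\<^esub>x\<in>B. a \<odot>\<^bsub>V\<^esub> (co v x \<odot>\<^bsub>V\<^esub> x))"
      using in_V by (intro finsum_cong') (auto simp: smult_smult)
    also have "\<dots> = a \<odot>\<^bsub>V\<^esub> v"
      using v in_V by (subst smult_finsum[symmetric]) (auto simp: co)
    finally show "co (a \<odot>\<^bsub>V\<^esub> v) k = a * co v k"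
      using v k unique[of "a \<odot>\<^bsub>V\<^esub> v" "\<lambda>x. a * co v x"] by simp
  next
    fix j k assume jk: "j \<in> B" "k \<in> B"
    have "(\<Oplus>\<^bsub>V\<^esub>x\<in>B. (if j = x then 1 else 0) \<odot>\<^bsub>V\<^esub> x) =
        (\<Oplus>\<^bsub>V\<^esub>x\<in>B. if x = j then j else \<zero>\<^bsub>V\<^esub>)"
      using in_V jk by (intro finsum_cong') auto
    also have "\<dots> = j" using jk fin in_V by (intro finsum_delta)
    finally show "co j k = (if j = k then 1 else 0)"
      using jk in_V unique[of j "\<lambda>x. if j = x then 1 else 0" k] by simp
  qed (auto simp: fin co in_V)
  then show ?thesis by blast
qed

lemma coordinate_system_of_ordered_basis:
  assumes "ordered_basis V bs"
  shows "\<exists>co. coordinate_system V {..<length bs} ((!) bs) co"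
proof -
  have "basis (set bs)" "distinct bs" using assms by (auto simp: ordered_basis_def)
  then obtain co where "coordinate_system V (set bs) (\<lambda>x. x) co"
    using coordinate_system_of_basis by blast
  moreover have "bij_betw ((!) bs) {..<length bs} (set bs)"
    using \<open>distinct bs\<close> by (rule bij_betw_nth) auto
  ultimately show ?thesis using coordinate_system.reindex by blast
qed

lemma coordinate_system_exists:
  assumes "fin_dim"
  shows "\<exists>b co. coordinate_system V {..<dim} b co"
proof -
  obtain B where B: "finite B" "basis B" using finite_basis_exists[OF assms] by blast
  obtain bs where bs: "set bs = B" "distinct bs" using finite_distinct_list[OF B(1)] by blast
  then have "ordered_basis V bs" using B by (simp add: ordered_basis_def)
  moreover have "length bs = dim" using bs B dim_basis distinct_card by metis
  ultimately show ?thesis using coordinate_system_of_ordered_basis by metis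
qed

lemma dim_pos:
  assumes "fin_dim" "carrier V \<noteq> {\<zero>\<^bsub>V\<^esub>}"
  shows "0 < dim"
proof (rule ccontr)
  assume "\<not> 0 < dim"
  obtain b co where "coordinate_system V {..<dim} b co"
    using coordinate_system_exists[OF assms(1)] by blast
  then interpret coordinate_system V "{..<dim}" b co .
  \<comment> \<open>In dimension 0 the expansion of a vector is an empty sum.\<close>
  have "v = \<zero>\<^bsub>V\<^esub>" if "v \<in> carrier V" for v
    using expansion[OF that] \<open>\<not> 0 < dim\<close> by simp
  with assms(2) show False by auto
qed

text \<open>Span and linear independence of subsets of \<open>U\<close> mean the same in
  \<open>U\<close> and in \<open>V\<close>. Hence the dimension of \<open>V\<close> bounds all
  independent subsets of \<open>U\<close>, a maximal one exists and is a basis of \<open>U\<close>;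
  if it has as many elements as the dimension of \<open>V\<close>, it is a basis of \<open>V\<close>
  as well. The last claim makes dimensions drop strictly for proper subspaces.\<close>

lemma subspace_fin_dim:
  assumes fd: "fin_dim" and U: "VectorSpace.subspace class_ring U V"
  shows "vectorspace.fin_dim class_ring (V\<lparr>carrier := U\<rparr>)"
    and "vectorspace.dim class_ring (V\<lparr>carrier := U\<rparr>) \<le> dim"
    and "vectorspace.dim class_ring (V\<lparr>carrier := U\<rparr>) = dim \<Longrightarrow> U = carrier V"
proof -
  interpret U: vectorspace class_ring "V\<lparr>carrier := U\<rparr>" by (rule subspace_is_vs[OF U])
  have UV: "U \<subseteq> carrier V" using subspaceD[OF U] by blast
  have sub: "submodule class_ring U V" using U by (simp add: VectorSpace.subspace_def)
  have li: "U.lin_dep S = lin_dep S" if "S \<subseteq> U" for S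
    using span_li_not_depend(2)[OF that sub] by simp
  have span: "U.span S = span S" if "S \<subseteq> U" for S
    using span_li_not_depend(1)[OF that sub] by simp
  let ?P = "\<lambda>S. S \<subseteq> carrier (V\<lparr>carrier := U\<rparr>) \<and> U.lin_indpt S"
  have bound: "finite S \<and> card S \<le> dim" if "?P S" for S
    using that li_le_dim[OF fd, of S] UV li by auto
  have "?P {}" using li[of "{}"] by (auto simp: lin_dep_def)
  then obtain B where B: "finite B" "maximal B ?P"
    using maximal_exists[of ?P dim] bound by meson
  then have basis_B: "U.basis B" using U.max_li_is_basis by blast
  then show "U.fin_dim"
    using B unfolding U.fin_dim_def U.basis_def by blast
  have card_B: "U.dim = card B" using U.dim_basis[OF B(1) basis_B] .
  have B': "?P B" using B(2) by (simp add: maximal_def)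
  then show "U.dim \<le> dim" using bound card_B by simp
  assume "U.dim = dim"
  then have "basis B"
    using B' B(1) UV li card_B fd by (intro dim_li_is_basis) auto
  then have "carrier V = span B" by (simp add: basis_def)
  also have "\<dots> = U" using span B' basis_B by (simp add: U.basis_def)
  finally show "U = carrier V" by simp
qed

text \<open>Extend a basis \<open>A\<close> of \<open>U\<close> to a basis \<open>B\<close> of
  \<open>V\<close>, keep the vectors of \<open>A\<close> and send those of \<open>B - A\<close> to
  zero.\<close>

lemma subspace_projection:
  assumes fd: "fin_dim" and U: "VectorSpace.subspace class_ring U V"
  shows "\<exists>p. linear_map class_ring V V p \<and> p ` carrier V \<subseteq> U \<and> (\<forall>u\<in>U. p u = u)"
proof -
  interpret U: vectorspace class_ring "V\<lparr>carrier := U\<rparr>" by (rule subspace_is_vs[OF U])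
  have UV: "U \<subseteq> carrier V" using subspaceD[OF U] by blast
  have sub: "submodule class_ring U V" using U by (simp add: VectorSpace.subspace_def)
  obtain A where A: "finite A" "U.basis A"
    using U.finite_basis_exists[OF subspace_fin_dim(1)[OF fd U]] by blast
  then have AU: "A \<subseteq> U" and span_A: "span A = U" and li_A: "lin_indpt A"
    using span_li_not_depend[of A U] sub by (auto simp: U.basis_def)
  have "\<exists>B. finite B \<and> maximal B (\<lambda>S. S \<subseteq> carrier V \<and> lin_indpt S \<and> A \<subseteq> S)"
  proof (rule maximal_exists[of _ dim A])
    show "A \<subseteq> carrier V \<and> lin_indpt A \<and> A \<subseteq> A" using AU UV li_A by blast
  qed (use li_le_dim[OF fd] in blast)
  then obtain B where B: "finite B" "maximal B (\<lambda>S. S \<subseteq> carrier V \<and> lin_indpt S \<and> A \<subseteq> S)"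
    by blast
  then have AB: "A \<subseteq> B" by (simp add: maximal_def)
  \<comment> \<open>An independent set larger than \<open>B\<close> contains \<open>A\<close> too,
    so maximality among the sets containing \<open>A\<close> is maximality among all independent
    sets.\<close>
  have "maximal B (\<lambda>S. S \<subseteq> carrier V \<and> lin_indpt S)"
    using B(2) unfolding maximal_def by (meson subset_trans)
  then have "basis B" by (rule max_li_is_basis)
  then obtain co where "coordinate_system V B (\<lambda>x. x) co"
    using coordinate_system_of_basis[OF B(1)] by blast
  then interpret B: coordinate_system V B "\<lambda>x. x" co .
  let ?f = "\<lambda>x. if x \<in> A then x else \<zero>\<^bsub>V\<^esub>"
  let ?p = "\<lambda>v. \<Oplus>\<^bsub>V\<^esub>k\<in>B. co v k \<odot>\<^bsub>V\<^esub> ?f k"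
  have f: "?f \<in> B \<rightarrow> carrier V" using AU UV by auto
  have f': "?f x \<in> U" for x using AU subspaceD(2)[OF U] by auto
  have lin: "linear_map class_ring V V ?p"
    by (rule B.linear_extension(1)[OF vectorspace_axioms f])
  have pA: "?p a = a" if "a \<in> A" for a
    using B.linear_extension(2)[OF vectorspace_axioms f, of a] that AB by auto
  have "?p v \<in> U" for v
    using f' subspaceD(4)[OF U] by (intro subspace_finsum[OF U]) auto
  moreover have "?p u = u" if u: "u \<in> U" for u
  proof -
    obtain c where c: "lincomb c A = u"
      using finite_in_span[OF A(1) subset_trans[OF AU UV], of u] u unfolding span_A by blast
    have AV: "a \<in> carrier V" if "a \<in> A" for a using that AU UV by blast
    have "?p u = (\<Oplus>\<^bsub>V\<^esub>a\<in>A. ?p (c a \<odot>\<^bsub>V\<^esub> a))"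
      using AV unfolding c[symmetric] lincomb_def by (intro linear_mapD(7)[OF lin]) auto
    also have "\<dots> = (\<Oplus>\<^bsub>V\<^esub>a\<in>A. c a \<odot>\<^bsub>V\<^esub> a)"
    proof (rule finsum_cong')
      fix a assume a: "a \<in> A"
      show "?p (c a \<odot>\<^bsub>V\<^esub> a) = c a \<odot>\<^bsub>V\<^esub> a"
        using linear_mapD(5)[OF lin, of a "c a"] pA[OF a] AV[OF a] by simp
    qed (use AV in auto)
    finally show ?thesis using c by (simp add: lincomb_def)
  qed
  ultimately show ?thesis using lin by blast
qed

end

text \<open>Algebraic closedness of the complex field enters here: the matrix of \<open>T\<close> in
  coordinates has nonempty spectrum because the dimension is positive. An eigenvector of the matrix
  is the coordinate vector of an eigenvector of \<open>T\<close>.\<close>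

lemma linear_endomorphism_eigenvector:
  fixes V :: "(complex, 'v) module"
  assumes T: "linear_map class_ring V V T" and fd: "vectorspace.fin_dim class_ring V"
    and nontrivial: "carrier V \<noteq> {\<zero>\<^bsub>V\<^esub>}"
  shows "\<exists>a v. v \<in> carrier V \<and> v \<noteq> \<zero>\<^bsub>V\<^esub> \<and> T v = a \<odot>\<^bsub>V\<^esub> v"
proof -
  interpret complex_vectorspace V
    using linear_mapD(1)[OF T] by (rule complex_vectorspaceI)
  obtain b co where "coordinate_system V {..<dim} b co"
    using coordinate_system_exists[OF fd] by blast
  then interpret coordinate_system V "{..<dim}" b co .
  define M where "M = mat dim dim (\<lambda>(i, j). co (T (b j)) i)"
  have M: "M \<in> carrier_mat dim dim" by (simp add: M_def)
  obtain a where "a \<in> spectrum M"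
    using spectrum_non_empty[OF M dim_pos[OF fd nontrivial]] by blast
  then obtain x where "eigenvector M x a" by (auto simp: spectrum_def eigenvalue_def)
  then have x: "x \<in> carrier_vec dim" "x \<noteq> 0\<^sub>v dim" "M *\<^sub>v x = a \<cdot>\<^sub>v x"
    using M by (auto simp: eigenvector_def)
  define v where "v = (\<Oplus>\<^bsub>V\<^esub>j\<in>{..<dim}. x $ j \<odot>\<^bsub>V\<^esub> b j)"
  have v: "v \<in> carrier V" unfolding v_def by (rule finsum_closed) auto
  have co_v: "co v i = x $ i" if "i < dim" for i
    using that unfolding v_def by (subst co_lincomb) auto
  have "T v = a \<odot>\<^bsub>V\<^esub> v"
  proof (rule coordinates_eqI)
    fix i assume i: "i \<in> {..<dim}"
    have "T v = (\<Oplus>\<^bsub>V\<^esub>j\<in>{..<dim}. T (x $ j \<odot>\<^bsub>V\<^esub> b j))"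
      unfolding v_def by (intro linear_mapD(7)[OF T]) auto
    then have "co (T v) i = (\<Sum>j<dim. co (T (x $ j \<odot>\<^bsub>V\<^esub> b j)) i)"
      using i linear_mapD(3)[OF T] by (simp add: co_finsum)
    also have "\<dots> = (\<Sum>j<dim. M $$ (i, j) * x $ j)"
      using i linear_mapD(3,5)[OF T] by (intro sum.cong) (auto simp: co_smult M_def)
    also have "\<dots> = (M *\<^sub>v x) $ i"
      using i M x(1) by (auto simp: scalar_prod_def row_def lessThan_atLeast0 intro!: sum.cong)
    also have "\<dots> = co (a \<odot>\<^bsub>V\<^esub> v) i"
      using i x v by (simp add: co_smult co_v)
    finally show "co (T v) i = co (a \<odot>\<^bsub>V\<^esub> v) i" .
  qed (use v linear_mapD(3)[OF T] in auto)
  moreover have "v \<noteq> \<zero>\<^bsub>V\<^esub>"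
  proof
    assume "v = \<zero>\<^bsub>V\<^esub>"
    then have "x $ i = 0" if "i < dim" for i using that co_v co_zero[of i] by simp
    then have "x = 0\<^sub>v dim" using x(1) by (intro eq_vecI) auto
    with x(2) show False by simp
  qed
  ultimately show ?thesis using v by blast
qed

section \<open>Direct sums\<close>

text \<open>A direct sum with its projections as part of the data. They are linear endomorphisms of
  the whole space, so they can be composed with other linear maps, which the unique-existence form
  of \<open>internal_direct_sum\<close> does not offer directly.\<close>

locale projection_system = complex_vectorspace V
  for V :: "(complex, 'v) module" +
  fixes P :: "'p set" and U :: "'p \<Rightarrow> 'v set" and \<pi> :: "'p \<Rightarrow> 'v \<Rightarrow> 'v"
  assumes finite_index [simp]: "finite P"
    and summand: "p \<in> P \<Longrightarrow> VectorSpace.subspace class_ring (U p) V"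
    and projection_linear: "p \<in> P \<Longrightarrow> linear_map class_ring V V (\<pi> p)"
    and projection_in: "p \<in> P \<Longrightarrow> v \<in> carrier V \<Longrightarrow> \<pi> p v \<in> U p"
    and projection_summand: "p \<in> P \<Longrightarrow> q \<in> P \<Longrightarrow> u \<in> U q \<Longrightarrow> \<pi> p u = (if p = q then u else \<zero>\<^bsub>V\<^esub>)"
    and sum_projections: "v \<in> carrier V \<Longrightarrow> (\<Oplus>\<^bsub>V\<^esub>p\<in>P. \<pi> p v) = v"
begin

lemma summand_in: "p \<in> P \<Longrightarrow> u \<in> U p \<Longrightarrow> u \<in> carrier V"
  using subspaceD(1)[OF summand] by blast

text \<open>This is the uniqueness of components: a family of summand vectors can be read off from
  its sum.\<close>

lemma projection_finsum:
  assumes f: "f \<in> (\<Pi> p\<in>P. U p)" and p: "p \<in> P"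
  shows "\<pi> p (\<Oplus>\<^bsub>V\<^esub>q\<in>P. f q) = f p"
proof -
  have f: "f q \<in> U q" if "q \<in> P" for q using f that by auto
  have "\<pi> p (\<Oplus>\<^bsub>V\<^esub>q\<in>P. f q) = (\<Oplus>\<^bsub>V\<^esub>q\<in>P. \<pi> p (f q))"
    using f by (intro linear_mapD(7)[OF projection_linear[OF p]]) (auto intro: summand_in)
  also have "\<dots> = (\<Oplus>\<^bsub>V\<^esub>q\<in>P. if q = p then f p else \<zero>\<^bsub>V\<^esub>)"
    using f p summand_in by (intro finsum_cong') (auto simp: projection_summand[OF _ _ f])
  also have "\<dots> = f p"
    using f p by (intro finsum_delta) (auto intro: summand_in)
  finally show ?thesis .
qed

lemma internal_direct_sum: "internal_direct_sum V P U"
  unfolding internal_direct_sum_def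
proof (intro conjI ballI)
  fix v assume v: "v \<in> carrier V"
  let ?f = "restrict (\<lambda>p. \<pi> p v) P"
  show "\<exists>!f. f \<in> (\<Pi>\<^sub>E p\<in>P. U p) \<and> v = (\<Oplus>\<^bsub>V\<^esub>p\<in>P. f p)"
  proof (rule ex1I[of _ ?f])
    have "(\<Oplus>\<^bsub>V\<^esub>p\<in>P. ?f p) = (\<Oplus>\<^bsub>V\<^esub>p\<in>P. \<pi> p v)"
      using v by (intro finsum_cong') (auto intro: summand_in projection_in)
    then show "?f \<in> (\<Pi>\<^sub>E p\<in>P. U p) \<and> v = (\<Oplus>\<^bsub>V\<^esub>p\<in>P. ?f p)"
      using v by (auto simp: sum_projections projection_in)
  next
    fix f assume f: "f \<in> (\<Pi>\<^sub>E p\<in>P. U p) \<and> v = (\<Oplus>\<^bsub>V\<^esub>p\<in>P. f p)"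
    then have "\<pi> p v = f p" if "p \<in> P" for p
      using projection_finsum[of f p] that by auto
    with f show "f = ?f" by (intro ext) (auto simp: PiE_def extensional_def)
  qed
qed (rule summand)

text \<open>Complete reducibility indexes the summands by the subspaces themselves; this passes to
  the pairs of a type and a copy number.\<close>

lemma reindex:
  assumes h: "bij_betw h P' P"
  shows "projection_system V P' (\<lambda>p. U (h p)) (\<lambda>p. \<pi> (h p))"
proof (intro projection_system.intro projection_system_axioms.intro complex_vectorspace_axioms)
  show "finite P'" using h bij_betw_finite finite_index by blast
next
  fix v assume v: "v \<in> carrier V"
  have "(\<Oplus>\<^bsub>V\<^esub>p\<in>P'. \<pi> (h p) v) = (\<Oplus>\<^bsub>V\<^esub>p\<in>h ` P'. \<pi> p v)"
    using h v by (subst finsum_reindex) (auto simp: bij_betw_def intro!: summand_in[OF _ projection_in])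
  then show "(\<Oplus>\<^bsub>V\<^esub>p\<in>P'. \<pi> (h p) v) = v"
    using h v by (simp add: bij_betw_def sum_projections)
next
  fix p q u assume "p \<in> P'" "q \<in> P'" "u \<in> U (h q)"
  then show "\<pi> (h p) u = (if p = q then u else \<zero>\<^bsub>V\<^esub>)"
    using h projection_summand[of "h p" "h q" u] by (auto simp: bij_betw_def inj_on_def)
qed (use h in \<open>auto simp: bij_betw_def inj_on_def summand projection_linear projection_in\<close>)

end

text \<open>Let \<open>\<pi> p v\<close> be the component at \<open>p\<close> of the unique
  decomposition of \<open>v\<close>. Linearity and the values on summands all come from uniqueness:
  write down a family in the summands with the right sum and compare.\<close>

lemma (in complex_vectorspace) projection_system_exists:
  assumes fin: "finite P" and ids: "internal_direct_sum V P U"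
  shows "\<exists>\<pi>. projection_system V P U \<pi>"
proof -
  have U: "VectorSpace.subspace class_ring (U p) V" if "p \<in> P" for p
    using ids that by (simp add: internal_direct_sum_def)
  have ex1: "\<exists>!f. f \<in> (\<Pi>\<^sub>E p\<in>P. U p) \<and> v = (\<Oplus>\<^bsub>V\<^esub>p\<in>P. f p)" if "v \<in> carrier V" for v
    using ids that by (simp add: internal_direct_sum_def)
  define \<pi> where "\<pi> p v = (THE f. f \<in> (\<Pi>\<^sub>E p\<in>P. U p) \<and> v = (\<Oplus>\<^bsub>V\<^esub>p\<in>P. f p)) p" for p v
  have \<pi>: "(\<lambda>p. \<pi> p v) \<in> (\<Pi>\<^sub>E p\<in>P. U p)" "(\<Oplus>\<^bsub>V\<^esub>p\<in>P. \<pi> p v) = v" if "v \<in> carrier V" for v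
    using theI'[OF ex1[OF that]] by (simp_all add: \<pi>_def)
  have in_V: "u \<in> carrier V" if "p \<in> P" "u \<in> U p" for p u
    using subspaceD(1)[OF U] that by blast
  have unique: "\<pi> p v = f p"
    if "v \<in> carrier V" "\<And>q. q \<in> P \<Longrightarrow> f q \<in> U q" "(\<Oplus>\<^bsub>V\<^esub>q\<in>P. f q) = v" "p \<in> P" for v f p
  proof -
    \<comment> \<open>Uniqueness in \<open>internal_direct_sum\<close> concerns extensional
      families, so an arbitrary family is first restricted to \<open>P\<close>.\<close>
    have "(\<Oplus>\<^bsub>V\<^esub>q\<in>P. restrict f P q) = (\<Oplus>\<^bsub>V\<^esub>q\<in>P. f q)"
      using that in_V by (intro finsum_cong') auto
    then have "(THE f. f \<in> (\<Pi>\<^sub>E p\<in>P. U p) \<and> v = (\<Oplus>\<^bsub>V\<^esub>p\<in>P. f p)) = restrict f P"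
      using that by (intro the1_equality ex1) auto
    then show ?thesis using that by (simp add: \<pi>_def)
  qed
  have \<pi>_in: "\<pi> p v \<in> U p" if "v \<in> carrier V" "p \<in> P" for p v
    using \<pi>(1)[OF that(1)] that(2) by (auto simp: PiE_def)
  have "projection_system V P U \<pi>"
  proof (intro projection_system.intro projection_system_axioms.intro complex_vectorspace_axioms)
    fix p assume p: "p \<in> P"
    show "linear_map class_ring V V (\<pi> p)"
    proof (rule linear_mapI[OF vectorspace_axioms vectorspace_axioms])
      fix v w assume vw: "v \<in> carrier V" "w \<in> carrier V"
      have "(\<Oplus>\<^bsub>V\<^esub>q\<in>P. \<pi> q v \<oplus>\<^bsub>V\<^esub> \<pi> q w) = v \<oplus>\<^bsub>V\<^esub> w"
        using vw \<pi>_in in_V by (subst finsum_addf) (auto simp: \<pi>(2))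
      then show "\<pi> p (v \<oplus>\<^bsub>V\<^esub> w) = \<pi> p v \<oplus>\<^bsub>V\<^esub> \<pi> p w"
        using vw \<pi>_in p subspaceD(3)[OF U] by (intro unique) auto
    next
      fix a v assume v: "v \<in> carrier V"
      have "(\<Oplus>\<^bsub>V\<^esub>q\<in>P. a \<odot>\<^bsub>V\<^esub> \<pi> q v) = a \<odot>\<^bsub>V\<^esub> v"
        using v \<pi>_in in_V by (subst smult_finsum[symmetric]) (auto simp: \<pi>(2))
      then show "\<pi> p (a \<odot>\<^bsub>V\<^esub> v) = a \<odot>\<^bsub>V\<^esub> \<pi> p v"
        using v \<pi>_in p subspaceD(4)[OF U] by (intro unique) auto
    qed (use p \<pi>_in in_V in blast)
  next
    fix p q u assume pq: "p \<in> P" "q \<in> P" "u \<in> U q"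
    have "(\<Oplus>\<^bsub>V\<^esub>x\<in>P. if x = q then u else \<zero>\<^bsub>V\<^esub>) = u"
      using pq in_V by (intro finsum_delta fin) auto
    then show "\<pi> p u = (if p = q then u else \<zero>\<^bsub>V\<^esub>)"
      using pq in_V subspaceD(2)[OF U] by (intro unique) auto
  qed (use fin U \<pi> \<pi>_in in auto)
  then show ?thesis by blast
qed

section \<open>Representations\<close>

definition intertwiner ::
  "('g, 'x) monoid_scheme \<Rightarrow> (complex, 'v) module \<Rightarrow> ('g \<Rightarrow> 'v \<Rightarrow> 'v) \<Rightarrow>
   (complex, 'w) module \<Rightarrow> ('g \<Rightarrow> 'w \<Rightarrow> 'w) \<Rightarrow> ('v \<Rightarrow> 'w) \<Rightarrow> bool" where
  "intertwiner G V \<rho> W \<sigma> T \<longleftrightarrow> linear_map class_ring V W T \<and>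
     (\<forall>g\<in>carrier G. \<forall>v\<in>carrier V. T (\<rho> g v) = \<sigma> g (T v))"

lemma isomorphic_reps_iff:
  "isomorphic_reps G V \<rho> W \<sigma> \<longleftrightarrow>
     (\<exists>T. intertwiner G V \<rho> W \<sigma> T \<and> bij_betw T (carrier V) (carrier W))"
  by (auto simp: isomorphic_reps_def intertwiner_def)

lemma intertwinerD:
  assumes "intertwiner G V \<rho> W \<sigma> T"
  shows "linear_map class_ring V W T" "\<And>v. v \<in> carrier V \<Longrightarrow> T v \<in> carrier W"
    "\<And>g v. g \<in> carrier G \<Longrightarrow> v \<in> carrier V \<Longrightarrow> T (\<rho> g v) = \<sigma> g (T v)"
proof -
  show T: "linear_map class_ring V W T" using assms by (simp add: intertwiner_def)
  show "\<And>v. v \<in> carrier V \<Longrightarrow> T v \<in> carrier W" using linear_mapD(3)[OF T] .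
  show "\<And>g v. g \<in> carrier G \<Longrightarrow> v \<in> carrier V \<Longrightarrow> T (\<rho> g v) = \<sigma> g (T v)"
    using assms by (simp add: intertwiner_def)
qed

lemma intertwiner_comp:
  assumes "intertwiner G V \<rho> W \<sigma> T" "intertwiner G W \<sigma> X \<tau> S"
  shows "intertwiner G V \<rho> X \<tau> (\<lambda>v. S (T v))"
  using intertwinerD[OF assms(1)] intertwinerD[OF assms(2)]
    linear_map_comp[OF intertwinerD(1)[OF assms(1)] intertwinerD(1)[OF assms(2)]]
  by (simp add: intertwiner_def)

lemma intertwiner_inv_into:
  assumes T: "intertwiner G V \<rho> W \<sigma> T" and bij: "bij_betw T (carrier V) (carrier W)"
    and \<rho>: "\<And>g v. g \<in> carrier G \<Longrightarrow> v \<in> carrier V \<Longrightarrow> \<rho> g v \<in> carrier V"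
  shows "intertwiner G W \<sigma> V \<rho> (inv_into (carrier V) T)"
  unfolding intertwiner_def
proof (intro conjI ballI)
  show "linear_map class_ring W V (inv_into (carrier V) T)"
    using intertwinerD(1)[OF T] bij by (rule linear_map_inv_into)
  fix g w assume g: "g \<in> carrier G" and w: "w \<in> carrier W"
  then obtain v where v: "v \<in> carrier V" "w = T v"
    using bij by (auto simp: bij_betw_def)
  then have "\<sigma> g w = T (\<rho> g v)" using intertwinerD(3)[OF T g] by simp
  then show "inv_into (carrier V) T (\<sigma> g w) = \<rho> g (inv_into (carrier V) T w)"
    using v g \<rho> bij by (simp add: bij_betw_def)
qed

lemma isomorphic_reps_trans:
  assumes "isomorphic_reps G V \<rho> W \<sigma>" "isomorphic_reps G W \<sigma> X \<tau>"
  shows "isomorphic_reps G V \<rho> X \<tau>"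
proof -
  obtain T S where "intertwiner G V \<rho> W \<sigma> T" "bij_betw T (carrier V) (carrier W)"
    "intertwiner G W \<sigma> X \<tau> S" "bij_betw S (carrier W) (carrier X)"
    using assms by (auto simp: isomorphic_reps_iff)
  then show ?thesis
    using intertwiner_comp[of G V \<rho> W \<sigma> T X \<tau> S]
      bij_betw_trans[of T "carrier V" "carrier W" S "carrier X"]
    by (auto simp: isomorphic_reps_iff comp_def)
qed

lemma fin_dim_repD:
  assumes "fin_dim_rep G V \<rho>"
  shows "vectorspace class_ring V" "vectorspace.fin_dim class_ring V"
    and "\<And>g. g \<in> carrier G \<Longrightarrow> linear_map class_ring V V (\<rho> g)"
    and "\<And>g v. g \<in> carrier G \<Longrightarrow> v \<in> carrier V \<Longrightarrow> \<rho> g v \<in> carrier V"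
    and "\<And>v. v \<in> carrier V \<Longrightarrow> \<rho> \<one>\<^bsub>G\<^esub> v = v"
    and "\<And>g h v. g \<in> carrier G \<Longrightarrow> h \<in> carrier G \<Longrightarrow> v \<in> carrier V \<Longrightarrow>
      \<rho> (g \<otimes>\<^bsub>G\<^esub> h) v = \<rho> g (\<rho> h v)"
proof -
  show lin: "linear_map class_ring V V (\<rho> g)" if "g \<in> carrier G" for g
    using assms that by (simp add: fin_dim_rep_def)
  show "\<rho> g v \<in> carrier V" if "g \<in> carrier G" "v \<in> carrier V" for g v
    using linear_mapD(3)[OF lin] that by blast
qed (use assms in \<open>simp_all add: fin_dim_rep_def\<close>)

lemma irreducible_repD:
  assumes "irreducible_rep G V \<rho>"
  shows "fin_dim_rep G V \<rho>" "carrier V \<noteq> {\<zero>\<^bsub>V\<^esub>}"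
    and "\<And>U. invariant_subspace G V \<rho> U \<Longrightarrow> U = {\<zero>\<^bsub>V\<^esub>} \<or> U = carrier V"
  using assms by (auto simp: irreducible_rep_def)

lemma invariant_subspaceD:
  assumes "invariant_subspace G V \<rho> U"
  shows "VectorSpace.subspace class_ring U V"
    and "\<And>g u. g \<in> carrier G \<Longrightarrow> u \<in> U \<Longrightarrow> \<rho> g u \<in> U"
  using assms by (auto simp: invariant_subspace_def)

lemma fin_dim_rep_subspace:
  assumes V: "fin_dim_rep G V \<rho>" and U: "invariant_subspace G V \<rho> U"
  shows "fin_dim_rep G (V\<lparr>carrier := U\<rparr>) \<rho>"
proof -
  note V' = fin_dim_repD[OF V] and U' = invariant_subspaceD[OF U]
  interpret complex_vectorspace V using V'(1) by (rule complex_vectorspaceI)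
  have UV: "\<And>u. u \<in> U \<Longrightarrow> u \<in> carrier V" using subspaceD(1)[OF U'(1)] by blast
  have "linear_map class_ring (V\<lparr>carrier := U\<rparr>) (V\<lparr>carrier := U\<rparr>) (\<rho> g)" if g: "g \<in> carrier G" for g
    using UV U'(2) g linear_mapD(4,5)[OF V'(3)[OF g]] subspace_is_vs[OF U'(1)]
    by (intro linear_mapI) auto
  then show ?thesis
    using UV V' subspace_is_vs[OF U'(1)] subspace_fin_dim(1)[OF V'(2) U'(1)]
    by (simp add: fin_dim_rep_def)
qed

section \<open>Schur's lemma\<close>

lemma invariant_kernel:
  assumes V: "fin_dim_rep G V \<rho>" and W: "fin_dim_rep G W \<sigma>" and T: "intertwiner G V \<rho> W \<sigma> T"
  shows "invariant_subspace G V \<rho> {v \<in> carrier V. T v = \<zero>\<^bsub>W\<^esub>}"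
proof -
  interpret V: complex_vectorspace V using fin_dim_repD(1)[OF V] by (rule complex_vectorspaceI)
  interpret W: complex_vectorspace W using fin_dim_repD(1)[OF W] by (rule complex_vectorspaceI)
  note lin = linear_mapD[OF intertwinerD(1)[OF T]]
  show ?thesis
    using lin fin_dim_repD(4)[OF V] intertwinerD(3)[OF T] linear_mapD(6)[OF fin_dim_repD(3)[OF W]]
    by (auto simp: invariant_subspace_def intro!: V.subspaceI)
qed

lemma invariant_image:
  assumes V: "fin_dim_rep G V \<rho>" and T: "intertwiner G V \<rho> W \<sigma> T"
  shows "invariant_subspace G W \<sigma> (T ` carrier V)"
proof -
  note lin = linear_mapD[OF intertwinerD(1)[OF T]]
  interpret V: complex_vectorspace V using fin_dim_repD(1)[OF V] by (rule complex_vectorspaceI)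
  interpret W: complex_vectorspace W using lin(2) by (rule complex_vectorspaceI)
  have "VectorSpace.subspace class_ring (T ` carrier V) W"
  proof (rule W.subspaceI)
    show "\<zero>\<^bsub>W\<^esub> \<in> T ` carrier V" using lin(6) V.zero_closed by (metis imageI)
    fix v w a assume "v \<in> T ` carrier V"
    then show "a \<odot>\<^bsub>W\<^esub> v \<in> T ` carrier V"
      using lin(5) V.smult_in by (metis (no_types) imageE imageI)
    assume "w \<in> T ` carrier V"
    then show "v \<oplus>\<^bsub>W\<^esub> w \<in> T ` carrier V"
      using \<open>v \<in> T ` carrier V\<close> lin(4) V.add.m_closed by (metis (no_types) imageE imageI)
  qed (use lin(3) in blast)
  moreover have "\<sigma> g (T v) \<in> T ` carrier V" if "g \<in> carrier G" "v \<in> carrier V" for g v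
    using that intertwinerD(3)[OF T, symmetric] fin_dim_repD(4)[OF V] by simp
  ultimately show ?thesis by (auto simp: invariant_subspace_def)
qed

lemma linear_map_injI:
  fixes V :: "(complex, 'v) module" and W :: "(complex, 'w) module"
  assumes T: "linear_map class_ring V W T" and ker: "{v \<in> carrier V. T v = \<zero>\<^bsub>W\<^esub>} = {\<zero>\<^bsub>V\<^esub>}"
  shows "inj_on T (carrier V)"
proof -
  interpret linear_map class_ring V W T by fact
  show ?thesis by (rule Ke0_imp_inj) (use ker in \<open>simp add: ker_def\<close>)
qed

text \<open>A nonzero value of \<open>T\<close> means that the kernel is not everything and the
  image is not zero. Both are invariant, so irreducibility makes \<open>T\<close> injective and
  surjective, which is an isomorphism.\<close>

lemma schur_zero:
  assumes V: "irreducible_rep G V \<rho>" and W: "irreducible_rep G W \<sigma>"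
    and T: "intertwiner G V \<rho> W \<sigma> T" and noniso: "\<not> isomorphic_reps G V \<rho> W \<sigma>"
    and v: "v \<in> carrier V"
  shows "T v = \<zero>\<^bsub>W\<^esub>"
proof (rule ccontr)
  assume nz: "T v \<noteq> \<zero>\<^bsub>W\<^esub>"
  note V' = irreducible_repD[OF V] and W' = irreducible_repD[OF W]
  have "{v \<in> carrier V. T v = \<zero>\<^bsub>W\<^esub>} = {\<zero>\<^bsub>V\<^esub>}"
    using V'(3)[OF invariant_kernel[OF V'(1) W'(1) T]] v nz by blast
  then have "inj_on T (carrier V)" by (rule linear_map_injI[OF intertwinerD(1)[OF T]])
  moreover have "T ` carrier V = carrier W"
    using W'(3)[OF invariant_image[OF V'(1) T]] v nz by blast
  ultimately show False
    using noniso T by (auto simp: isomorphic_reps_iff bij_betw_def)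
qed

lemma schur_scalar:
  assumes V: "irreducible_rep G V \<rho>" and T: "intertwiner G V \<rho> V \<rho> T"
  shows "\<exists>a. \<forall>v\<in>carrier V. T v = a \<odot>\<^bsub>V\<^esub> v"
proof -
  note V' = irreducible_repD[OF V] and rep = fin_dim_repD[OF irreducible_repD(1)[OF V]]
  interpret complex_vectorspace V using rep(1) by (rule complex_vectorspaceI)
  obtain a u where u: "u \<in> carrier V" "u \<noteq> \<zero>\<^bsub>V\<^esub>" "T u = a \<odot>\<^bsub>V\<^esub> u"
    using linear_endomorphism_eigenvector[OF intertwinerD(1)[OF T] rep(2) V'(2)] by blast
  \<comment> \<open>the eigenspace for \<open>a\<close> is invariant and nonzero, hence everything\<close>
  let ?S = "\<lambda>v. T v \<oplus>\<^bsub>V\<^esub> (- a) \<odot>\<^bsub>V\<^esub> v"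
  have neg: "(- a) \<odot>\<^bsub>V\<^esub> v = \<ominus>\<^bsub>V\<^esub> (a \<odot>\<^bsub>V\<^esub> v)" if "v \<in> carrier V" for v
    using that smult_smult[of v "-1" a] minus_one_smult[of "a \<odot>\<^bsub>V\<^esub> v"] by simp
  have zero_iff: "?S v = \<zero>\<^bsub>V\<^esub> \<longleftrightarrow> T v = a \<odot>\<^bsub>V\<^esub> v" if "v \<in> carrier V" for v
    using that intertwinerD(2)[OF T] minus_other_side[of "T v" "a \<odot>\<^bsub>V\<^esub> v"]
    by (simp add: neg a_minus_def)
  have "linear_map class_ring V V ?S"
    using intertwinerD(1)[OF T] rep(1) by (intro linear_map_add linear_map_smult linear_map_id)
  moreover have "?S (\<rho> g v) = \<rho> g (?S v)" if "g \<in> carrier G" "v \<in> carrier V" for g v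
    using that linear_mapD(4,5)[OF rep(3)] intertwinerD(2,3)[OF T] by simp
  ultimately have S: "intertwiner G V \<rho> V \<rho> ?S" by (simp add: intertwiner_def)
  have "u \<in> {v \<in> carrier V. ?S v = \<zero>\<^bsub>V\<^esub>}" using u zero_iff[OF u(1)] by blast
  then have "{v \<in> carrier V. ?S v = \<zero>\<^bsub>V\<^esub>} = carrier V"
    using V'(3)[OF invariant_kernel[OF V'(1) V'(1) S]] u(2) by blast
  then show ?thesis using zero_iff by (metis (mono_tags, lifting) mem_Collect_eq)
qed

section \<open>Maschke's theorem\<close>

text \<open>Average an arbitrary linear projection onto \<open>U\<close> over the group.\<close>

lemma maschke_projection:
  assumes G: "group G" "finite (carrier G)" and V: "fin_dim_rep G V \<rho>"
    and U: "invariant_subspace G V \<rho> U"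
  shows "\<exists>q. intertwiner G V \<rho> V \<rho> q \<and> q ` carrier V \<subseteq> U \<and> (\<forall>u\<in>U. q u = u)"
proof -
  interpret G: group G by fact
  note rep = fin_dim_repD[OF V] and U' = invariant_subspaceD[OF U]
  interpret complex_vectorspace V using rep(1) by (rule complex_vectorspaceI)
  have UV: "\<And>u. u \<in> U \<Longrightarrow> u \<in> carrier V" using subspaceD(1)[OF U'(1)] by blast
  obtain p where p: "linear_map class_ring V V p" "\<And>v. v \<in> carrier V \<Longrightarrow> p v \<in> U" "\<And>u. u \<in> U \<Longrightarrow> p u = u"
    using subspace_projection[OF rep(2) U'(1)] by blast
  \<comment> \<open>Every conjugate \<open>F g\<close> of the projection \<open>p\<close> fixes
    \<open>U\<close> pointwise, so their sum acts on \<open>U\<close> as the order of the group;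
    \<open>c\<close> normalizes this to the identity.\<close>
  define c where "c = 1 / (of_nat (card (carrier G)) :: complex)"
  define F where "F g v = \<rho> g (p (\<rho> (inv\<^bsub>G\<^esub> g) v))" for g v
  define q where "q v = c \<odot>\<^bsub>V\<^esub> (\<Oplus>\<^bsub>V\<^esub>g\<in>carrier G. F g v)" for v
  have F_U: "F g v \<in> U" if "g \<in> carrier G" "v \<in> carrier V" for g v
    using that p(2) U'(2) rep(4) by (simp add: F_def)
  have F_lin: "linear_map class_ring V V (F g)" if "g \<in> carrier G" for g
    unfolding F_def using that by (intro linear_map_comp[OF _ linear_map_comp[OF p(1)]] rep(3)) auto
  have lin: "linear_map class_ring V V q"
    unfolding q_def using F_lin by (intro linear_map_smult linear_map_finsum rep(1))
  have "q v \<in> U" if "v \<in> carrier V" for v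
    unfolding q_def using that F_U subspaceD(4)[OF U'(1)]
    by (intro subspaceD(4)[OF U'(1)] subspace_finsum[OF U'(1)]) auto
  moreover have "q u = u" if u: "u \<in> U" for u
  proof -
    have "F g u = u" if "g \<in> carrier G" for g
      using that u U'(2) p(3) rep(6)[of g "inv\<^bsub>G\<^esub> g" u] rep(5) UV by (simp add: F_def)
    then have "(\<Oplus>\<^bsub>V\<^esub>g\<in>carrier G. F g u) = (\<Oplus>\<^bsub>V\<^esub>g\<in>carrier G. 1 \<odot>\<^bsub>V\<^esub> u)"
      using u UV by (intro finsum_cong') auto
    also have "\<dots> = of_nat (card (carrier G)) \<odot>\<^bsub>V\<^esub> u"
      using u UV sum_smult[of u "\<lambda>_. 1" "carrier G"] by simp
    moreover have "card (carrier G) \<noteq> 0" using G(2) G.one_closed by auto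
    ultimately show ?thesis using u UV by (simp add: q_def c_def smult_smult)
  qed
  moreover have "q (\<rho> h v) = \<rho> h (q v)" if h: "h \<in> carrier G" and v: "v \<in> carrier V" for h v
  proof -
    note lin_h = linear_mapD[OF rep(3)[OF h]]
    have F_h: "F (h \<otimes>\<^bsub>G\<^esub> g) (\<rho> h v) = \<rho> h (F g v)" if g: "g \<in> carrier G" for g
    proof -
      have "inv\<^bsub>G\<^esub> (h \<otimes>\<^bsub>G\<^esub> g) \<otimes>\<^bsub>G\<^esub> h = inv\<^bsub>G\<^esub> g"
        using g h by (simp add: G.inv_mult_group G.m_assoc)
      then have "\<rho> (inv\<^bsub>G\<^esub> (h \<otimes>\<^bsub>G\<^esub> g)) (\<rho> h v) = \<rho> (inv\<^bsub>G\<^esub> g) v"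
        using g h v rep(6)[of "inv\<^bsub>G\<^esub> (h \<otimes>\<^bsub>G\<^esub> g)" h v] by simp
      then show ?thesis
        using g h v rep(4) linear_mapD(3)[OF p(1)] by (simp add: F_def rep(6))
    qed
    have surj: "(\<otimes>\<^bsub>G\<^esub>) h ` carrier G = carrier G"
      using G.surj_const_mult[OF h] .
    have "\<rho> h (q v) = c \<odot>\<^bsub>V\<^esub> \<rho> h (\<Oplus>\<^bsub>V\<^esub>g\<in>carrier G. F g v)"
      unfolding q_def using F_U UV v by (intro lin_h(5)) auto
    also have "\<rho> h (\<Oplus>\<^bsub>V\<^esub>g\<in>carrier G. F g v) = (\<Oplus>\<^bsub>V\<^esub>g\<in>carrier G. \<rho> h (F g v))"
      using F_U UV v by (intro lin_h(7)) auto
    also have "\<dots> = (\<Oplus>\<^bsub>V\<^esub>g\<in>carrier G. F (h \<otimes>\<^bsub>G\<^esub> g) (\<rho> h v))"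
      using F_h F_U UV h v rep(4) by (intro finsum_cong') auto
    also have "\<dots> = (\<Oplus>\<^bsub>V\<^esub>g\<in>(\<otimes>\<^bsub>G\<^esub>) h ` carrier G. F g (\<rho> h v))"
      using F_U UV h v rep(4) G.inj_on_cmult[OF h] surj
      by (intro finsum_reindex[symmetric]) auto
    finally show ?thesis by (simp add: q_def surj)
  qed
  ultimately show ?thesis
    using lin by (intro exI[of _ q]) (auto simp: intertwiner_def)
qed

section \<open>Transport to spaces of complex vectors\<close>

lemma irreducible_rep_transport:
  fixes V :: "(complex, 'v) module" and W :: "(complex, 'w) module"
  assumes V: "irreducible_rep G V \<rho>" and T: "linear_map class_ring V W T"
    and bij: "bij_betw T (carrier V) (carrier W)"
  defines "\<sigma> \<equiv> \<lambda>g w. T (\<rho> g (inv_into (carrier V) T w))"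
  shows "irreducible_rep G W \<sigma>" and "intertwiner G V \<rho> W \<sigma> T"
proof -
  note V' = irreducible_repD[OF V] and rep = fin_dim_repD[OF irreducible_repD(1)[OF V]]
    and T' = linear_mapD[OF T]
  interpret V: complex_vectorspace V using rep(1) by (rule complex_vectorspaceI)
  interpret W: complex_vectorspace W using T'(2) by (rule complex_vectorspaceI)
  have inv_T [simp]: "inv_into (carrier V) T (T v) = v" if "v \<in> carrier V" for v
    using that bij by (simp add: bij_betw_def)
  have inv_in [simp]: "inv_into (carrier V) T w \<in> carrier V" "T (inv_into (carrier V) T w) = w"
    if "w \<in> carrier W" for w
    using that bij by (metis bij_betw_def f_inv_into_f inv_into_into)+
  show tw: "intertwiner G V \<rho> W \<sigma> T"
    using T by (simp add: intertwiner_def \<sigma>_def)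
  have "fin_dim_rep G W \<sigma>"
    unfolding fin_dim_rep_def
  proof (intro conjI ballI)
    interpret L: linear_map class_ring V W T by fact
    show "W.fin_dim" using L.surj_fin_dim rep(2) bij by (simp add: bij_betw_def)
    show "linear_map class_ring W W (\<sigma> g)" if "g \<in> carrier G" for g
      unfolding \<sigma>_def
      by (intro linear_map_comp[OF linear_map_comp[OF _ rep(3)[OF that]] T] linear_map_inv_into T bij)
  qed (use T' rep in \<open>simp_all add: \<sigma>_def\<close>)
  moreover have "carrier W \<noteq> {\<zero>\<^bsub>W\<^esub>}"
  proof
    assume "carrier W = {\<zero>\<^bsub>W\<^esub>}"
    then have "T v = T \<zero>\<^bsub>V\<^esub>" if "v \<in> carrier V" for v using T'(3)[OF that] T'(6) by auto
    then have "v = \<zero>\<^bsub>V\<^esub>" if "v \<in> carrier V" for v using that inv_T V.zero_closed by metis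
    then show False using V'(2) V.zero_closed by blast
  qed
  moreover have "U = {\<zero>\<^bsub>W\<^esub>} \<or> U = carrier W" if U: "invariant_subspace G W \<sigma> U" for U
  proof -
    note U' = invariant_subspaceD[OF U] and U'' = W.subspaceD[OF invariant_subspaceD(1)[OF U]]
    \<comment> \<open>Pull an invariant subspace of \<open>W\<close> back to \<open>V\<close>, where
      irreducibility is known. Since \<open>T\<close> is onto, the subspace is recovered as the
      image of its preimage.\<close>
    let ?U = "{v \<in> carrier V. T v \<in> U}"
    have image: "U = T ` ?U"
    proof
      show "U \<subseteq> T ` ?U"
      proof
        fix u assume "u \<in> U"
        then show "u \<in> T ` ?U"
          using U''(1) by (intro image_eqI[of _ _ "inv_into (carrier V) T u"]) auto
      qed
    qed blast
    have "VectorSpace.subspace class_ring ?U V"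
      using T' U'' by (intro V.subspaceI) auto
    moreover have "\<rho> g v \<in> ?U" if "g \<in> carrier G" "v \<in> ?U" for g v
      using that U'(2)[of g "T v"] rep(4) intertwinerD(3)[OF tw] by auto
    ultimately have "invariant_subspace G V \<rho> ?U" by (auto simp: invariant_subspace_def)
    then have "?U = {\<zero>\<^bsub>V\<^esub>} \<or> ?U = carrier V" by (rule V'(3))
    then show ?thesis using image T'(6) bij by (auto simp: bij_betw_def)
  qed
  ultimately show "irreducible_rep G W \<sigma>" by (simp add: irreducible_rep_def)
qed

text \<open>The list is known to be complete only for representations on complex vectors.
  Coordinates identify \<open>V\<close> with such a space, the action is carried over by
  conjugation, and the isomorphism with a listed representation is composed with the coordinate
  map.\<close>

lemma isomorphic_to_listed_irrep:
  fixes V :: "(complex, 'v) module"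
  assumes list: "full_irrep_list G r Vs \<mu>" and V: "irreducible_rep G V \<rho>"
  shows "\<exists>i\<in>{1..r}. isomorphic_reps G V \<rho> (Vs i) (\<mu> i)"
proof -
  note rep = fin_dim_repD[OF irreducible_repD(1)[OF V]]
  interpret complex_vectorspace V using rep(1) by (rule complex_vectorspaceI)
  obtain b co where "coordinate_system V {..<dim} b co"
    using coordinate_system_exists[OF rep(2)] by blast
  then interpret coordinate_system V "{..<dim}" b co .
  let ?W = "module_vec TYPE(complex) dim"
  let ?T = "\<lambda>v. vec dim (co v)"
  have T: "linear_map class_ring V ?W ?T"
    by (intro linear_mapI vectorspace_axioms vec_vs)
      (auto simp: module_vec_def co_add co_smult intro!: eq_vecI)
  have bij: "bij_betw ?T (carrier V) (carrier ?W)"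
  proof (rule bij_betw_byWitness[where f' = "\<lambda>x. \<Oplus>\<^bsub>V\<^esub>i\<in>{..<dim}. x $ i \<odot>\<^bsub>V\<^esub> b i"])
    show "\<forall>v\<in>carrier V. (\<Oplus>\<^bsub>V\<^esub>i\<in>{..<dim}. ?T v $ i \<odot>\<^bsub>V\<^esub> b i) = v"
    proof
      fix v assume v: "v \<in> carrier V"
      have "(\<Oplus>\<^bsub>V\<^esub>i\<in>{..<dim}. ?T v $ i \<odot>\<^bsub>V\<^esub> b i) = (\<Oplus>\<^bsub>V\<^esub>i\<in>{..<dim}. co v i \<odot>\<^bsub>V\<^esub> b i)"
        by (intro finsum_cong') auto
      then show "(\<Oplus>\<^bsub>V\<^esub>i\<in>{..<dim}. ?T v $ i \<odot>\<^bsub>V\<^esub> b i) = v" using expansion[OF v] by simp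
    qed
  qed (auto simp: module_vec_def co_lincomb intro!: eq_vecI finsum_closed)
  obtain i where "i \<in> {1..r}" and
    "isomorphic_reps G ?W (\<lambda>g w. ?T (\<rho> g (inv_into (carrier V) ?T w))) (Vs i) (\<mu> i)"
    using list irreducible_rep_transport(1)[OF V T bij] unfolding full_irrep_list_def by blast
  moreover have "isomorphic_reps G V \<rho> ?W (\<lambda>g w. ?T (\<rho> g (inv_into (carrier V) ?T w)))"
    using irreducible_rep_transport(2)[OF V T bij] bij isomorphic_reps_iff by blast
  ultimately show ?thesis using isomorphic_reps_trans by blast
qed

section \<open>Complete reducibility and multiplicities\<close>

lemma complete_reducibility:
  fixes V :: "(complex, 'v) module"
  assumes G: "group G" "finite (carrier G)" and V: "fin_dim_rep G V \<rho>"
  shows "\<exists>P \<pi>. projection_system V P (\<lambda>X. X) \<pi> \<and>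
    (\<forall>X\<in>P. invariant_subspace G V \<rho> X \<and> irreducible_rep G (V\<lparr>carrier := X\<rparr>) \<rho>)"
  using V
\<comment> \<open>Strong induction on the dimension: a proper nonzero invariant subspace has the
  kernel of an equivariant projection as invariant complement, and both have smaller dimension. The
  zero space is the empty sum.\<close>
proof (induction "vectorspace.dim class_ring V" arbitrary: V rule: less_induct)
  case less
  note rep = fin_dim_repD[OF less.prems]
  interpret complex_vectorspace V using rep(1) by (rule complex_vectorspaceI)
  have self_sub: "VectorSpace.subspace class_ring (carrier V) V"
    by (rule subspaceI) auto
  consider "carrier V = {\<zero>\<^bsub>V\<^esub>}" | "irreducible_rep G V \<rho>"
    | U where "invariant_subspace G V \<rho> U" "U \<noteq> {\<zero>\<^bsub>V\<^esub>}" "U \<noteq> carrier V"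
    using less.prems by (auto simp: irreducible_rep_def)
  then show ?case
  proof cases
    case 1
    then have "projection_system V {} (\<lambda>X. X) (\<lambda>_ v. v)"
      by (intro projection_system.intro projection_system_axioms.intro complex_vectorspace_axioms) auto
    then show ?thesis by blast
  next
    case 2
    have "projection_system V {carrier V} (\<lambda>X. X) (\<lambda>_ v. v)"
      by (intro projection_system.intro projection_system_axioms.intro complex_vectorspace_axioms)
        (auto simp: self_sub linear_map_id vectorspace_axioms)
    moreover have "invariant_subspace G V \<rho> (carrier V)"
      using rep(4) self_sub by (auto simp: invariant_subspace_def)
    ultimately show ?thesis using 2 by force
  next
    case (3 U)
    obtain q where q: "intertwiner G V \<rho> V \<rho> q" "\<And>v. v \<in> carrier V \<Longrightarrow> q v \<in> U" "\<And>u. u \<in> U \<Longrightarrow> q u = u"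
      using maschke_projection[OF G less.prems 3(1)] by blast
    note q_lin = linear_mapD[OF intertwinerD(1)[OF q(1)]]
    define U' where "U' = {v \<in> carrier V. q v = \<zero>\<^bsub>V\<^esub>}"
    have U': "invariant_subspace G V \<rho> U'"
      unfolding U'_def using less.prems q(1) by (intro invariant_kernel)
    have subU: "VectorSpace.subspace class_ring U V" and subU': "VectorSpace.subspace class_ring U' V"
      using 3(1) U' by (auto simp: invariant_subspace_def)
    have UV: "\<And>u. u \<in> U \<Longrightarrow> u \<in> carrier V" using subspaceD(1)[OF subU] by blast
    \<comment> \<open>The complementary projection, onto the kernel \<open>U'\<close> of
      \<open>q\<close>; the factor \<open>- 1\<close> keeps it within sums and multiples of linear
      maps.\<close>
    define q' where "q' v = v \<oplus>\<^bsub>V\<^esub> (- 1) \<odot>\<^bsub>V\<^esub> q v" for v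
    have q'_lin: "linear_map class_ring V V q'"
      unfolding q'_def
      by (intro linear_map_add linear_map_smult linear_map_id vectorspace_axioms intertwinerD(1)[OF q(1)])
    have q_neg: "q (\<ominus>\<^bsub>V\<^esub> q v) = \<ominus>\<^bsub>V\<^esub> q v" if "v \<in> carrier V" for v
      using that q_lin(3) q_lin(5)[of "q v" "- 1"] q(2,3) by (simp add: minus_one_smult)
    have q'_in: "q' v \<in> U'" if "v \<in> carrier V" for v
      using that q_lin(3,4) by (simp add: U'_def q'_def minus_one_smult q_neg r_neg)
    have q'_U: "q' u = \<zero>\<^bsub>V\<^esub>" if "u \<in> U" for u
      using that UV q(3) by (simp add: q'_def minus_one_smult r_neg)
    have q'_U': "q' u = u" if "u \<in> U'" for u
      using that by (simp add: q'_def U'_def)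
    have sum_q: "q v \<oplus>\<^bsub>V\<^esub> q' v = v" if "v \<in> carrier V" for v
      using that q_lin(3) by (simp add: q'_def minus_one_smult add.m_lcomm r_neg)
    have dim_less: "vectorspace.dim class_ring (V\<lparr>carrier := X\<rparr>) < dim"
      if "VectorSpace.subspace class_ring X V" "X \<noteq> carrier V" for X
      using subspace_fin_dim(2,3)[OF rep(2) that(1)] that(2) by fastforce
    \<comment> \<open>If \<open>q\<close> vanished everywhere, the space \<open>U\<close> that it
      fixes would be zero.\<close>
    have proper: "U' \<noteq> carrier V"
    proof
      assume "U' = carrier V"
      then have "u = \<zero>\<^bsub>V\<^esub>" if "u \<in> U" for u
        using that UV q(3) by (force simp: U'_def)
      then show False using 3(2) subspaceD(2)[OF subU] by blast
    qed
    obtain P1 \<pi>1 P2 \<pi>2 where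
      P1: "projection_system (V\<lparr>carrier := U\<rparr>) P1 (\<lambda>X. X) \<pi>1"
        "\<And>X. X \<in> P1 \<Longrightarrow> invariant_subspace G (V\<lparr>carrier := U\<rparr>) \<rho> X \<and> irreducible_rep G (V\<lparr>carrier := X\<rparr>) \<rho>" and
      P2: "projection_system (V\<lparr>carrier := U'\<rparr>) P2 (\<lambda>X. X) \<pi>2"
        "\<And>X. X \<in> P2 \<Longrightarrow> invariant_subspace G (V\<lparr>carrier := U'\<rparr>) \<rho> X \<and> irreducible_rep G (V\<lparr>carrier := X\<rparr>) \<rho>"
      using less.hyps[OF dim_less[OF subU 3(3)] fin_dim_rep_subspace[OF less.prems 3(1)]]
        less.hyps[OF dim_less[OF subU' proper] fin_dim_rep_subspace[OF less.prems U']]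
      by auto
    interpret P1: projection_system "V\<lparr>carrier := U\<rparr>" P1 "\<lambda>X. X" \<pi>1 by (rule P1)
    interpret P2: projection_system "V\<lparr>carrier := U'\<rparr>" P2 "\<lambda>X. X" \<pi>2 by (rule P2)
    have trans: "invariant_subspace G V \<rho> Y"
      if X: "VectorSpace.subspace class_ring X V" and Y: "invariant_subspace G (V\<lparr>carrier := X\<rparr>) \<rho> Y" for X Y
    proof -
      interpret X: complex_vectorspace "V\<lparr>carrier := X\<rparr>"
        using subspace_is_vs[OF X] by (rule complex_vectorspaceI)
      show ?thesis
        using X.subspaceD[OF invariant_subspaceD(1)[OF Y]] subspaceD(1)[OF X] Y
        by (auto simp: invariant_subspace_def intro!: subspaceI)
    qed
    have inv1: "invariant_subspace G V \<rho> X" if "X \<in> P1" for X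
      using trans[OF subU] P1(2)[OF that] by blast
    have inv2: "invariant_subspace G V \<rho> X" if "X \<in> P2" for X
      using trans[OF subU'] P2(2)[OF that] by blast
    have sub1: "x \<in> U" if "X \<in> P1" "x \<in> X" for x X using P1.summand_in that by simp
    have sub2: "x \<in> U'" if "X \<in> P2" "x \<in> X" for x X using P2.summand_in that by simp
    \<comment> \<open>The summands are their own indices, so a subspace occurring in both families
      would be counted only once in the union. Such a subspace would be both fixed and annihilated
      by \<open>q'\<close>, hence zero, contrary to irreducibility.\<close>
    have disj: "P1 \<inter> P2 = {}"
    proof (rule ccontr)
      assume "P1 \<inter> P2 \<noteq> {}"
      then obtain X where X: "X \<in> P1" "X \<in> P2" by blast
      have "x = \<zero>\<^bsub>V\<^esub>" if "x \<in> X" for x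
        using q'_U[OF sub1[OF X(1) that]] q'_U'[OF sub2[OF X(2) that]] by simp
      moreover have "\<zero>\<^bsub>V\<^esub> \<in> X"
        using subspaceD(2)[OF invariant_subspaceD(1)[OF inv1[OF X(1)]]] .
      ultimately have "X = {\<zero>\<^bsub>V\<^esub>}" by blast
      then show False using irreducible_repD(2) P1(2)[OF X(1)] by fastforce
    qed
    \<comment> \<open>\<open>\<pi>1\<close> and \<open>\<pi>2\<close> are projections within
      \<open>U\<close> and \<open>U'\<close> only, so a vector is first sent there by
      \<open>q\<close> or \<open>q'\<close>.\<close>
    define \<pi> where "\<pi> X v = (if X \<in> P1 then \<pi>1 X (q v) else \<pi>2 X (q' v))" for X v
    have \<pi>1_in: "\<pi>1 X u \<in> X" if "X \<in> P1" "u \<in> U" for X u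
      using P1.projection_in that by simp
    have \<pi>2_in: "\<pi>2 X u \<in> X" if "X \<in> P2" "u \<in> U'" for X u
      using P2.projection_in that by simp
    have "projection_system V (P1 \<union> P2) (\<lambda>X. X) \<pi>"
    proof (intro projection_system.intro projection_system_axioms.intro complex_vectorspace_axioms)
      fix X assume X: "X \<in> P1 \<union> P2"
      show "VectorSpace.subspace class_ring X V"
        using X inv1 inv2 by (auto simp: invariant_subspace_def)
      show "linear_map class_ring V V (\<pi> X)"
      proof (cases "X \<in> P1")
        case True
        \<comment> \<open>The composite of \<open>q\<close> with its codomain narrowed to
          \<open>U\<close>, the projection within \<open>U\<close>, and the inclusion of
          \<open>U\<close> into \<open>V\<close>.\<close>
        have "linear_map class_ring V V (\<lambda>v. \<pi>1 X (q v))"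
          using q(2) by (intro linear_map_comp[OF linear_map_comp[OF linear_map_corestrict
            P1.projection_linear[OF True]] linear_map_inclusion] intertwinerD(1)[OF q(1)] subU) auto
        then show ?thesis by (rule linear_map_cong) (simp add: \<pi>_def True)
      next
        case False
        then have "X \<in> P2" using X by blast
        then have "linear_map class_ring V V (\<lambda>v. \<pi>2 X (q' v))"
          using q'_in by (intro linear_map_comp[OF linear_map_comp[OF linear_map_corestrict
            P2.projection_linear] linear_map_inclusion] q'_lin subU') auto
        then show ?thesis by (rule linear_map_cong) (simp add: \<pi>_def False)
      qed
      show "\<pi> X v \<in> X" if "v \<in> carrier V" for v
        using X that \<pi>1_in \<pi>2_in q(2) q'_in by (auto simp: \<pi>_def)
      fix Y u assume Y: "Y \<in> P1 \<union> P2" and u: "u \<in> Y"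
      show "\<pi> X u = (if X = Y then u else \<zero>\<^bsub>V\<^esub>)"
      proof (cases "Y \<in> P1")
        case True
        then have "u \<in> U" using u sub1 by blast
        then show ?thesis
          using True X u q(3) q'_U disj P1.projection_summand[of X Y u]
            linear_mapD(6)[OF P2.projection_linear, of X]
          by (auto simp: \<pi>_def)
      next
        case False
        then have Y2: "Y \<in> P2" and uU': "u \<in> U'" using Y u sub2 by blast+
        have "\<pi>2 X u = (if X = Y then u else \<zero>\<^bsub>V\<^esub>)" if "X \<in> P2"
          using P2.projection_summand[OF that Y2 u] by simp
        moreover have "q u = \<zero>\<^bsub>V\<^esub>" using uU' by (simp add: U'_def)
        ultimately show ?thesis
          using False X q'_U'[OF uU'] linear_mapD(6)[OF P1.projection_linear, of X]
          by (cases "X \<in> P1") (auto simp: \<pi>_def)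
      qed
    next
      fix v assume v: "v \<in> carrier V"
      have in_V: "x \<in> carrier V" if "X \<in> P1 \<union> P2" "x \<in> X" for X x
        using that sub1 sub2 UV by (auto simp: U'_def)
      have in1: "\<pi>1 X (q v) \<in> carrier V" "\<pi>1 X (q v) \<in> U" if "X \<in> P1" for X
        using that \<pi>1_in[OF that q(2)[OF v]] in_V[of X] sub1[of X] by auto
      have in2: "\<pi>2 X (q' v) \<in> carrier V" "\<pi>2 X (q' v) \<in> U'" if "X \<in> P2" for X
        using that \<pi>2_in[OF that q'_in[OF v]] in_V[of X] sub2[of X] by auto
      have "(\<Oplus>\<^bsub>V\<^esub>X\<in>P1 \<union> P2. \<pi> X v) = (\<Oplus>\<^bsub>V\<^esub>X\<in>P1. \<pi> X v) \<oplus>\<^bsub>V\<^esub> (\<Oplus>\<^bsub>V\<^esub>X\<in>P2. \<pi> X v)"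
        using disj in1 in2 by (intro finsum_Un_disjoint) (auto simp: \<pi>_def)
      also have "(\<Oplus>\<^bsub>V\<^esub>X\<in>P1. \<pi> X v) = (\<Oplus>\<^bsub>V\<^esub>X\<in>P1. \<pi>1 X (q v))"
        using in1 by (intro finsum_cong') (auto simp: \<pi>_def)
      also have "\<dots> = q v"
        using in1 P1.sum_projections[of "q v"] q(2)[OF v] by (subst finsum_subspace[OF subU, symmetric]) auto
      also have "(\<Oplus>\<^bsub>V\<^esub>X\<in>P2. \<pi> X v) = (\<Oplus>\<^bsub>V\<^esub>X\<in>P2. \<pi>2 X (q' v))"
        using in2 disj by (intro finsum_cong') (auto simp: \<pi>_def)
      also have "\<dots> = q' v"
        using in2 P2.sum_projections[of "q' v"] q'_in[OF v] by (subst finsum_subspace[OF subU', symmetric]) auto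
      finally show "(\<Oplus>\<^bsub>V\<^esub>X\<in>P1 \<union> P2. \<pi> X v) = v" using sum_q[OF v] by simp
    qed simp
    moreover have "invariant_subspace G V \<rho> X \<and> irreducible_rep G (V\<lparr>carrier := X\<rparr>) \<rho>" if "X \<in> P1 \<union> P2" for X
      using that inv1 inv2 P1(2) P2(2) by blast
    ultimately show ?thesis by blast
  qed
qed

text \<open>Sort the irreducible summands by their type \<open>t X\<close> in the list. The
  multiplicity is the size of a fibre of \<open>t\<close>, and an enumeration of each fibre from 1
  turns the summands into pairs. Taking only types in the image of \<open>t\<close> makes the
  multiplicities positive.\<close>

lemma irrep_decomposition_exists:
  fixes V :: "(complex, 'v) module"
  assumes G: "group G" "finite (carrier G)" and list: "full_irrep_list G r Vs \<mu>"
    and V: "fin_dim_rep G V \<rho>"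
  shows "\<exists>I m. irrep_decomposition G r Vs \<mu> V \<rho> I m"
proof -
  obtain P \<pi> where P: "projection_system V P (\<lambda>X. X) \<pi>"
    and irr: "\<And>X. X \<in> P \<Longrightarrow> invariant_subspace G V \<rho> X \<and> irreducible_rep G (V\<lparr>carrier := X\<rparr>) \<rho>"
    using complete_reducibility[OF G V] by blast
  interpret projection_system V P "\<lambda>X. X" \<pi> by (rule P)
  have "\<forall>X\<in>P. \<exists>i. i \<in> {1..r} \<and> isomorphic_reps G (V\<lparr>carrier := X\<rparr>) \<rho> (Vs i) (\<mu> i)"
    using isomorphic_to_listed_irrep[OF list] irr by blast
  then obtain t where t: "\<And>X. X \<in> P \<Longrightarrow> t X \<in> {1..r} \<and> isomorphic_reps G (V\<lparr>carrier := X\<rparr>) \<rho> (Vs (t X)) (\<mu> (t X))"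
    by metis
  define m where "m i = card {X \<in> P. t X = i}" for i
  have "\<exists>e. bij_betw e {1..m i} {X \<in> P. t X = i}" for i
    unfolding m_def by (rule ex_bij_betw_nat_finite_1) simp
  then obtain e where e: "\<And>i. bij_betw (e i) {1..m i} {X \<in> P. t X = i}" by metis
  have e_in: "e i k \<in> P \<and> t (e i k) = i" if "k \<in> {1..m i}" for i k
    using bij_betwE[OF e[of i]] that by blast
  have "bij_betw (\<lambda>p. e (fst p) (snd p)) (SIGMA i:t ` P. {1..m i}) P"
  proof (rule bij_betw_imageI)
    show "inj_on (\<lambda>p. e (fst p) (snd p)) (SIGMA i:t ` P. {1..m i})"
    proof (rule inj_onI)
      fix p q assume p: "p \<in> (SIGMA i:t ` P. {1..m i})" and q: "q \<in> (SIGMA i:t ` P. {1..m i})"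
        and eq: "e (fst p) (snd p) = e (fst q) (snd q)"
      have mem: "snd p \<in> {1..m (fst p)}" "snd q \<in> {1..m (fst q)}"
        using p q by (auto simp: mem_Sigma_iff split: prod.splits)
      have fst: "fst p = fst q" using eq e_in[OF mem(1)] e_in[OF mem(2)] by metis
      then have "snd p = snd q"
        using mem eq bij_betw_imp_inj_on[OF e[of "fst p"]] by (auto dest: inj_onD)
      with fst show "p = q" by (simp add: prod_eq_iff)
    qed
    show "(\<lambda>p. e (fst p) (snd p)) ` (SIGMA i:t ` P. {1..m i}) = P"
    proof
      show "P \<subseteq> (\<lambda>p. e (fst p) (snd p)) ` (SIGMA i:t ` P. {1..m i})"
      proof
        fix X assume X: "X \<in> P"
        then have "X \<in> e (t X) ` {1..m (t X)}" using e[of "t X"] by (simp add: bij_betw_def)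
        then obtain k where "k \<in> {1..m (t X)}" "X = e (t X) k" by blast
        then show "X \<in> (\<lambda>p. e (fst p) (snd p)) ` (SIGMA i:t ` P. {1..m i})"
          using X by (intro image_eqI[of _ _ "(t X, k)"]) auto
      qed
    qed (use e_in in auto)
  qed
  then interpret E: projection_system V "SIGMA i:t ` P. {1..m i}" "\<lambda>p. e (fst p) (snd p)"
    "\<lambda>p. \<pi> (e (fst p) (snd p))"
    by (rule reindex)
  have "irrep_decomposition G r Vs \<mu> V \<rho> (t ` P) m"
    unfolding irrep_decomposition_def
  proof (intro conjI exI[of _ "\<lambda>p. e (fst p) (snd p)"] ballI)
    show "t ` P \<subseteq> {1..r}" using t by blast
    show "internal_direct_sum V (SIGMA i:t ` P. {1..m i}) (\<lambda>p. e (fst p) (snd p))"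
      by (rule E.internal_direct_sum)
    show "0 < m i" if "i \<in> t ` P" for i
      using that by (auto simp: m_def card_gt_0_iff)
    show "invariant_subspace G V \<rho> (e (fst (i, k)) (snd (i, k)))" if "k \<in> {1..m i}" for i k
      using irr e_in[OF that] by simp
    show "isomorphic_reps G (V\<lparr>carrier := e (fst (i, k)) (snd (i, k))\<rparr>) \<rho> (Vs i) (\<mu> i)" if "k \<in> {1..m i}" for i k
      using t e_in[OF that] by fastforce
  qed
  then show ?thesis by blast
qed

section \<open>Copies of irreducible representations as injections and projections\<close>

lemma irrep_decomposition_biproduct:
  fixes V :: "(complex, 'v) module"
  assumes V: "fin_dim_rep G V \<rho>" and dec: "irrep_decomposition G r Vs \<mu> V \<rho> I m"
  defines "P \<equiv> SIGMA i:I. {1..m i}"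
  obtains \<iota> \<pi> where
    "\<And>p. p \<in> P \<Longrightarrow> intertwiner G (Vs (fst p)) (\<mu> (fst p)) V \<rho> (\<iota> p)"
    "\<And>p. p \<in> P \<Longrightarrow> intertwiner G V \<rho> (Vs (fst p)) (\<mu> (fst p)) (\<pi> p)"
    "\<And>p q x. p \<in> P \<Longrightarrow> q \<in> P \<Longrightarrow> x \<in> carrier (Vs (fst q)) \<Longrightarrow>
      \<pi> p (\<iota> q x) = (if p = q then x else \<zero>\<^bsub>Vs (fst p)\<^esub>)"
    "\<And>v. v \<in> carrier V \<Longrightarrow> (\<Oplus>\<^bsub>V\<^esub>p\<in>P. \<iota> p (\<pi> p v)) = v"
proof -
  note rep = fin_dim_repD[OF V]
  interpret complex_vectorspace V using rep(1) by (rule complex_vectorspaceI)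
  obtain U where ids: "internal_direct_sum V P U"
    and U: "\<And>p. p \<in> P \<Longrightarrow> invariant_subspace G V \<rho> (U p)"
      "\<And>p. p \<in> P \<Longrightarrow> isomorphic_reps G (V\<lparr>carrier := U p\<rparr>) \<rho> (Vs (fst p)) (\<mu> (fst p))"
    using dec unfolding irrep_decomposition_def P_def by fastforce
  have "finite I" using dec finite_subset by (auto simp: irrep_decomposition_def)
  then have "finite P" by (simp add: P_def)
  then obtain \<pi> where "projection_system V P U \<pi>" using projection_system_exists ids by blast
  then interpret projection_system V P U \<pi> .
  have "\<forall>p\<in>P. \<exists>\<phi>. intertwiner G (V\<lparr>carrier := U p\<rparr>) \<rho> (Vs (fst p)) (\<mu> (fst p)) \<phi> \<and>
      bij_betw \<phi> (U p) (carrier (Vs (fst p)))"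
    using U(2) by (simp add: isomorphic_reps_iff)
  then obtain \<phi> where \<phi>: "\<And>p. p \<in> P \<Longrightarrow> intertwiner G (V\<lparr>carrier := U p\<rparr>) \<rho> (Vs (fst p)) (\<mu> (fst p)) (\<phi> p)"
    and bij: "\<And>p. p \<in> P \<Longrightarrow> bij_betw (\<phi> p) (U p) (carrier (Vs (fst p)))"
    by metis
  let ?\<iota> = "\<lambda>p. inv_into (U p) (\<phi> p)"
  have \<iota>: "?\<iota> p x \<in> U p" "\<phi> p (?\<iota> p x) = x" if "p \<in> P" "x \<in> carrier (Vs (fst p))" for p x
    using bij[OF that(1)] that(2) by (metis bij_betw_def f_inv_into_f inv_into_into)+
  show thesis
  proof (rule that[of ?\<iota> "\<lambda>p v. \<phi> p (\<pi> p v)"])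
    fix p assume p: "p \<in> P"
    have "intertwiner G (Vs (fst p)) (\<mu> (fst p)) (V\<lparr>carrier := U p\<rparr>) \<rho> (?\<iota> p)"
      using intertwiner_inv_into[OF \<phi>[OF p]] bij[OF p] invariant_subspaceD(2)[OF U(1)[OF p]] by simp
    moreover have "intertwiner G (V\<lparr>carrier := U p\<rparr>) \<rho> V \<rho> (\<lambda>v. v)"
      using linear_map_inclusion[OF summand[OF p]] by (simp add: intertwiner_def)
    ultimately show "intertwiner G (Vs (fst p)) (\<mu> (fst p)) V \<rho> (?\<iota> p)"
      by (rule intertwiner_comp)
    \<comment> \<open>Apply \<open>\<rho> g\<close> to the decomposition of \<open>v\<close>. The
      summands are invariant, so the result is a decomposition of \<open>\<rho> g v\<close>, and its
      components must be the projections.\<close>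
    have "\<pi> p (\<rho> g v) = \<rho> g (\<pi> p v)" if g: "g \<in> carrier G" and v: "v \<in> carrier V" for g v
    proof -
      have "\<rho> g (\<Oplus>\<^bsub>V\<^esub>q\<in>P. \<pi> q v) = (\<Oplus>\<^bsub>V\<^esub>q\<in>P. \<rho> g (\<pi> q v))"
        using v by (intro linear_mapD(7)[OF rep(3)[OF g]]) (auto intro: summand_in projection_in)
      then have "\<rho> g v = (\<Oplus>\<^bsub>V\<^esub>q\<in>P. \<rho> g (\<pi> q v))" using sum_projections[OF v] by simp
      then show ?thesis
        using g v p invariant_subspaceD(2)[OF U(1)] projection_in
        by (simp add: projection_finsum)
    qed
    moreover have "linear_map class_ring V (V\<lparr>carrier := U p\<rparr>) (\<pi> p)"
      using projection_in[OF p]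
      by (intro linear_map_corestrict projection_linear summand p) auto
    ultimately have "intertwiner G V \<rho> (V\<lparr>carrier := U p\<rparr>) \<rho> (\<pi> p)"
      by (simp add: intertwiner_def)
    then show "intertwiner G V \<rho> (Vs (fst p)) (\<mu> (fst p)) (\<lambda>v. \<phi> p (\<pi> p v))"
      by (rule intertwiner_comp[OF _ \<phi>[OF p]])
    fix q x assume "q \<in> P" "x \<in> carrier (Vs (fst q))"
    then show "\<phi> p (\<pi> p (?\<iota> q x)) = (if p = q then x else \<zero>\<^bsub>Vs (fst p)\<^esub>)"
      using p \<iota> linear_mapD(6)[OF intertwinerD(1)[OF \<phi>[OF p]]] by (simp add: projection_summand)
  next
    fix v assume v: "v \<in> carrier V"
    have "(\<Oplus>\<^bsub>V\<^esub>p\<in>P. ?\<iota> p (\<phi> p (\<pi> p v))) = (\<Oplus>\<^bsub>V\<^esub>p\<in>P. \<pi> p v)"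
      using v bij projection_in summand_in
      by (intro finsum_cong') (auto simp: bij_betw_def)
    then show "(\<Oplus>\<^bsub>V\<^esub>p\<in>P. ?\<iota> p (\<phi> p (\<pi> p v))) = v" using sum_projections[OF v] by simp
  qed
qed

lemma irreducible_rep_dim_pos:
  assumes V: "irreducible_rep G V \<rho>"
  shows "0 < vectorspace.dim class_ring V"
proof -
  note V' = irreducible_repD[OF V] and rep = fin_dim_repD[OF irreducible_repD(1)[OF V]]
  interpret complex_vectorspace V using rep(1) by (rule complex_vectorspaceI)
  show ?thesis using dim_pos[OF rep(2) V'(2)] .
qed

text \<open>Expanding each component \<open>\<pi> p v\<close> in the basis of \<open>X p\<close> and
  pushing the terms forward by \<open>\<iota> p\<close> turns the sum of components into an
  expansion of \<open>v\<close>. The relation between \<open>\<pi>\<close> and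
  \<open>\<iota>\<close> makes the coordinates dual to the basis across different
  \<open>p\<close>.\<close>

lemma coordinate_system_biproduct:
  fixes V :: "(complex, 'v) module" and X :: "'p \<Rightarrow> (complex, 'u) module"
  assumes V: "vectorspace class_ring V" and P: "finite P"
    and X: "\<And>p. p \<in> P \<Longrightarrow> coordinate_system (X p) (K p) (b p) (co p)"
    and \<iota>: "\<And>p. p \<in> P \<Longrightarrow> linear_map class_ring (X p) V (\<iota> p)"
    and \<pi>: "\<And>p. p \<in> P \<Longrightarrow> linear_map class_ring V (X p) (\<pi> p)"
    and \<pi>_\<iota>: "\<And>p q x. p \<in> P \<Longrightarrow> q \<in> P \<Longrightarrow> x \<in> carrier (X q) \<Longrightarrow>
      \<pi> p (\<iota> q x) = (if p = q then x else \<zero>\<^bsub>X p\<^esub>)"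
    and sum: "\<And>v. v \<in> carrier V \<Longrightarrow> (\<Oplus>\<^bsub>V\<^esub>p\<in>P. \<iota> p (\<pi> p v)) = v"
  shows "coordinate_system V (Sigma P K) (\<lambda>x. \<iota> (fst x) (b (fst x) (snd x)))
    (\<lambda>v x. co (fst x) (\<pi> (fst x) v) (snd x))"
proof -
  interpret complex_vectorspace V using V by (rule complex_vectorspaceI)
  note X' = coordinate_system.finite_index[OF X] coordinate_system.basis_in[OF X]
    coordinate_system.co_add[OF X] coordinate_system.co_smult[OF X] coordinate_system.co_basis[OF X]
    coordinate_system.co_zero[OF X]
  note \<iota>' = linear_mapD[OF \<iota>] and \<pi>' = linear_mapD[OF \<pi>]
  show ?thesis
  proof (intro coordinate_system.intro coordinate_system_axioms.intro complex_vectorspace_axioms)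
    fix v assume v: "v \<in> carrier V"
    have in_V: "\<iota> p (b p k) \<in> carrier V" if "p \<in> P" "k \<in> K p" for p k
      using that X' \<iota>' by simp
    have "(\<Oplus>\<^bsub>V\<^esub>x\<in>Sigma P K. co (fst x) (\<pi> (fst x) v) (snd x) \<odot>\<^bsub>V\<^esub> \<iota> (fst x) (b (fst x) (snd x))) =
        (\<Oplus>\<^bsub>V\<^esub>p\<in>P. \<Oplus>\<^bsub>V\<^esub>k\<in>K p. co p (\<pi> p v) k \<odot>\<^bsub>V\<^esub> \<iota> p (b p k))"
      using P X' in_V by (intro finsum_Sigma) auto
    also have "\<dots> = (\<Oplus>\<^bsub>V\<^esub>p\<in>P. \<iota> p (\<pi> p v))"
    proof (rule finsum_cong')
      fix p assume p: "p \<in> P"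
      interpret X: coordinate_system "X p" "K p" "b p" "co p" by (rule X[OF p])
      have "(\<Oplus>\<^bsub>V\<^esub>k\<in>K p. co p (\<pi> p v) k \<odot>\<^bsub>V\<^esub> \<iota> p (b p k)) =
          (\<Oplus>\<^bsub>V\<^esub>k\<in>K p. \<iota> p (co p (\<pi> p v) k \<odot>\<^bsub>X p\<^esub> b p k))"
        using p in_V by (intro finsum_cong') (auto simp: \<iota>'(3,5))
      also have "\<dots> = \<iota> p (\<Oplus>\<^bsub>X p\<^esub>k\<in>K p. co p (\<pi> p v) k \<odot>\<^bsub>X p\<^esub> b p k)"
        by (intro \<iota>'(7)[OF p, symmetric]) auto
      also have "\<dots> = \<iota> p (\<pi> p v)"
        using v \<pi>'(3)[OF p] by (simp add: X.expansion)
      finally show "(\<Oplus>\<^bsub>V\<^esub>k\<in>K p. co p (\<pi> p v) k \<odot>\<^bsub>V\<^esub> \<iota> p (b p k)) = \<iota> p (\<pi> p v)" .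
    qed (use v \<iota>' \<pi>' in auto)
    finally show "(\<Oplus>\<^bsub>V\<^esub>x\<in>Sigma P K. co (fst x) (\<pi> (fst x) v) (snd x) \<odot>\<^bsub>V\<^esub>
        \<iota> (fst x) (b (fst x) (snd x))) = v"
      using sum[OF v] by simp
  next
    fix x y assume "x \<in> Sigma P K" "y \<in> Sigma P K"
    then show "co (fst y) (\<pi> (fst y) (\<iota> (fst x) (b (fst x) (snd x)))) (snd y) = (if x = y then 1 else 0)"
      by (cases x; cases y) (auto simp: X' \<pi>_\<iota>)
  qed (use P in \<open>auto simp: X' \<iota>' \<pi>'\<close>)
qed

section \<open>Block matrices\<close>

text \<open>One notion covers both kinds of matrix needed: it is a change of basis when
  \<open>x\<close> is another basis of the same space, and the matrix of a linear map when
  \<open>x\<close> lists the images of a basis.\<close>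

definition coordinate_matrix ::
  "nat \<Rightarrow> nat \<Rightarrow> ('v \<Rightarrow> nat \<Rightarrow> complex) \<Rightarrow> (nat \<Rightarrow> 'v) \<Rightarrow> complex mat" where
  "coordinate_matrix k n co x = mat k n (\<lambda>(i, j). co (x j) i)"

lemma coordinate_matrix_carrier [simp]: "coordinate_matrix k n co x \<in> carrier_mat k n"
  by (simp add: coordinate_matrix_def)

text \<open>Expand \<open>x j\<close> in the basis \<open>b\<close> and apply \<open>T\<close>. With
  \<open>T\<close> the identity this gives the inverses of the change-of-basis matrices; with
  \<open>T\<close> a map of the filter it gives the change of its matrix.\<close>

lemma coordinate_matrix_mult:
  assumes V: "coordinate_system V {..<n} b co" and W: "coordinate_system W {..<k} c co'"
    and T: "linear_map class_ring V W T" and x: "\<And>j. j < l \<Longrightarrow> x j \<in> carrier V"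
  shows "coordinate_matrix k n co' (\<lambda>j. T (b j)) * coordinate_matrix n l co x =
    coordinate_matrix k l co' (\<lambda>j. T (x j))"
proof (rule eq_matI)
  interpret V: coordinate_system V "{..<n}" b co by (rule V)
  interpret W: coordinate_system W "{..<k}" c co' by (rule W)
  note T' = linear_mapD[OF T]
  fix i j
  assume "i < dim_row (coordinate_matrix k l co' (\<lambda>j. T (x j)))"
    "j < dim_col (coordinate_matrix k l co' (\<lambda>j. T (x j)))"
  then have i: "i < k" and j: "j < l" by (simp_all add: coordinate_matrix_def)
  have "T (x j) = T (\<Oplus>\<^bsub>V\<^esub>m\<in>{..<n}. co (x j) m \<odot>\<^bsub>V\<^esub> b m)"
    using x[OF j] by (simp add: V.expansion)
  also have "\<dots> = (\<Oplus>\<^bsub>W\<^esub>m\<in>{..<n}. T (co (x j) m \<odot>\<^bsub>V\<^esub> b m))"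
    by (intro T'(7)) auto
  finally have "co' (T (x j)) i = (\<Sum>m<n. co' (T (co (x j) m \<odot>\<^bsub>V\<^esub> b m)) i)"
    using i T'(3) by (simp add: W.co_finsum)
  also have "\<dots> = (\<Sum>m<n. co' (T (b m)) i * co (x j) m)"
    using i T'(3,5) by (intro sum.cong) (auto simp: W.co_smult)
  finally show "(coordinate_matrix k n co' (\<lambda>j. T (b j)) * coordinate_matrix n l co x) $$ (i, j) =
      coordinate_matrix k l co' (\<lambda>j. T (x j)) $$ (i, j)"
    using i j by (simp add: coordinate_matrix_def scalar_prod_def lessThan_atLeast0)
qed (simp_all add: coordinate_matrix_def)

lemma coordinate_matrix_basis:
  assumes "coordinate_system V {..<n} b co"
  shows "coordinate_matrix n n co b = 1\<^sub>m n"
  using coordinate_system.co_basis[OF assms] by (intro eq_matI) (auto simp: coordinate_matrix_def)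

lemma is_matrix_of_coordinate_matrix:
  assumes W: "coordinate_system W {..<length cs} ((!) cs) co" and M: "is_matrix_of bs W cs T M"
  shows "M = coordinate_matrix (length cs) (length bs) co (\<lambda>j. T (bs ! j))"
  using M coordinate_system.co_lincomb[OF W]
  by (intro eq_matI) (auto simp: is_matrix_of_def coordinate_matrix_def)

section \<open>Segments and positions in the adapted basis\<close>

lemma offset_bound:
  fixes s :: nat
  assumes "finite S" "s \<in> S"
  shows "(\<Sum>t | t \<in> S \<and> t < s. len t) + len s \<le> (\<Sum>t\<in>S. len t :: nat)"
proof -
  have "(\<Sum>t | t \<in> S \<and> t < s. len t) + len s = (\<Sum>t\<in>insert s {t \<in> S. t < s}. len t)"
    using assms by simp
  also have "\<dots> \<le> (\<Sum>t\<in>S. len t)" using assms by (intro sum_mono2) auto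
  finally show ?thesis .
qed

lemma offset_mono:
  fixes s :: nat
  assumes "finite S" "s \<in> S" "s < s'"
  shows "(\<Sum>t | t \<in> S \<and> t < s. len t) + len s \<le> (\<Sum>t | t \<in> S \<and> t < s'. len t :: nat)"
proof -
  have "{t. t \<in> {t \<in> S. t < s'} \<and> t < s} = {t. t \<in> S \<and> t < s}" using assms by auto
  then show ?thesis using offset_bound[of "{t \<in> S. t < s'}" s len] assms by simp
qed

text \<open>The place of the basis vector number \<open>a\<close> (from 0) of the copy number \<open>k\<close> (from 1) of \<open>V\<^sub>i\<close> in the
  adapted basis. Letting the copy index vary slower than \<open>a\<close> puts the identity matrix in the
  right factor of the Kronecker product.\<close>

definition position :: "nat set \<Rightarrow> (nat \<Rightarrow> nat) \<Rightarrow> (nat \<Rightarrow> nat) \<Rightarrow> (nat \<times> nat) \<times> nat \<Rightarrow> nat" where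
  "position I m d = (\<lambda>((i, k), a). (\<Sum>t | t \<in> I \<and> t < i. m t * d t) + ((k - 1) * d i + a))"

definition position_index :: "nat set \<Rightarrow> (nat \<Rightarrow> nat) \<Rightarrow> (nat \<Rightarrow> nat) \<Rightarrow> ((nat \<times> nat) \<times> nat) set" where
  "position_index I m d = (SIGMA p:(SIGMA i:I. {1..m i}). {..<d (fst p)})"

lemma position_in_segment:
  fixes k m a d :: nat
  assumes "1 \<le> k" "k \<le> m" "a < d"
  shows "(k - 1) * d + a < m * d"
proof -
  have "(k - 1) * d + a < (k - 1) * d + d" using assms by simp
  also have "\<dots> = k * d" using assms by (cases k) auto
  also have "\<dots> \<le> m * d" using assms by simp
  finally show ?thesis .
qed

text \<open>A position can be decoded: the segments are disjoint, so it determines \<open>i\<close>,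
  and then the quotient and remainder of the offset by \<open>d i\<close> give the copy and the
  basis index. Surjectivity follows by counting.\<close>

lemma bij_betw_position:
  assumes I: "finite I"
  shows "bij_betw (position I m d) (position_index I m d) {..<\<Sum>i\<in>I. m i * d i}"
proof -
  let ?off = "\<lambda>i. \<Sum>t | t \<in> I \<and> t < i. m t * d t"
  have inj: "inj_on (position I m d) (position_index I m d)"
  proof (rule inj_onI)
    fix x y assume x: "x \<in> position_index I m d" and y: "y \<in> position_index I m d"
      and eq: "position I m d x = position I m d y"
    obtain i k a where x': "x = ((i, k), a)" "i \<in> I" "1 \<le> k" "k \<le> m i" "a < d i"
      using x by (auto simp: position_index_def)
    obtain j l b where y': "y = ((j, l), b)" "j \<in> I" "1 \<le> l" "l \<le> m j" "b < d j"
      using y by (auto simp: position_index_def)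
    have eq': "?off i + ((k - 1) * d i + a) = ?off j + ((l - 1) * d j + b)"
      using eq by (simp add: position_def x' y')
    have "i = j"
      using eq' offset_mono[OF I x'(2), of j "\<lambda>t. m t * d t"] offset_mono[OF I y'(2), of i "\<lambda>t. m t * d t"]
        position_in_segment[OF x'(3-5)] position_in_segment[OF y'(3-5)]
      by (cases i j rule: linorder_cases) auto
    moreover from this eq' have e: "(k - 1) * d i + a = (l - 1) * d i + b" by simp
    moreover have "a = b"
      using arg_cong[OF e, of "\<lambda>z. z mod d i"] x'(5) y'(5) \<open>i = j\<close> by simp
    moreover have "k - 1 = l - 1"
      using arg_cong[OF e, of "\<lambda>z. z div d i"] x'(5) y'(5) \<open>i = j\<close> by simp
    ultimately show "x = y" using x' y' by simp
  qed
  have "position I m d ` position_index I m d \<subseteq> {..<\<Sum>i\<in>I. m i * d i}"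
  proof (rule image_subsetI)
    fix x assume "x \<in> position_index I m d"
    then obtain i k a where *: "x = ((i, k), a)" "i \<in> I" "1 \<le> k" "k \<le> m i" "a < d i"
      by (auto simp: position_index_def)
    show "position I m d x \<in> {..<\<Sum>i\<in>I. m i * d i}"
      using offset_bound[OF I *(2), of "\<lambda>t. m t * d t"] position_in_segment[OF *(3-5)]
      by (simp add: position_def *(1))
  qed
  moreover have "card (position_index I m d) = (\<Sum>i\<in>I. m i * d i)"
    using I sum.Sigma[of I "\<lambda>i. {1..m i}" "\<lambda>i k. d i"]
    by (simp add: position_index_def case_prod_beta)
  ultimately show ?thesis
    using inj unfolding bij_betw_def by (intro conjI card_subset_eq) (simp_all add: card_image)
qed

text \<open>The decoding used for matrix entries; \<open>+ 1\<close> appears because copies are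
  numbered from 1 and positions from 0.\<close>

lemma position_inverse:
  assumes I: "finite I" and i: "i \<in> I" and p: "p < m i * d i"
  shows "inv_into (position_index I m d) (position I m d) ((\<Sum>t | t \<in> I \<and> t < i. m t * d t) + p) =
    ((i, p div d i + 1), p mod d i)"
proof (rule inv_into_f_eq)
  show "inj_on (position I m d) (position_index I m d)"
    using bij_betw_position[OF I] by (rule bij_betw_imp_inj_on)
  have "0 < d i" using p by (cases "d i") auto
  moreover have "p div d i < m i" using p by (simp add: less_mult_imp_div_less)
  ultimately show "((i, p div d i + 1), p mod d i) \<in> position_index I m d"
    using i by (simp add: position_index_def)
qed (simp add: position_def)

text \<open>The number \<open>a + p\<close> is the element of the interval with exactly
  \<open>p\<close> elements below it.\<close>

lemma pick_interval:
  assumes "p < l"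
  shows "pick {a..<a + l} p = a + p"
proof -
  have "{x \<in> {a..<a + l}. x < a + p} = {a..<a + p}" using assms by auto
  then show ?thesis using pick_card_in_set[of "a + p" "{a..<a + l}"] assms by simp
qed

lemma block_eq:
  assumes J: "finite J" "j \<in> J" and I: "finite I" "i \<in> I"
    and M: "M \<in> carrier_mat (\<Sum>j\<in>J. hts j) (\<Sum>i\<in>I. wds i)"
  shows "block J hts I wds M j i = mat (hts j) (wds i)
    (\<lambda>(p, q). M $$ ((\<Sum>t | t \<in> J \<and> t < j. hts t) + p, (\<Sum>t | t \<in> I \<and> t < i. wds t) + q))"
proof -
  \<comment> \<open>\<open>submatrix\<close> keeps only those indices that lie inside the matrix; a
    segment never reaches beyond the total length, so nothing is lost.\<close>
  have seg: "{x. x < (\<Sum>s\<in>S. len s) \<and> x \<in> segment S len s} = segment S len s"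
    if "finite S" "s \<in> S" for S s and len :: "nat \<Rightarrow> nat"
    using offset_bound[OF that, of len] by (auto simp: segment_def Let_def)
  have card: "card (segment S len s) = len s" for S s len by (simp add: segment_def Let_def)
  show ?thesis
    using M unfolding block_def submatrix_def
    by (intro eq_matI) (simp_all add: seg[OF J] seg[OF I] card, simp add: segment_def Let_def pick_interval)
qed

section \<open>The block form of an equivariant filter\<close>

text \<open>The bases \<open>\<beta> i\<close> of the irreducible representations are parameters, so
  that \<open>V\<close> and \<open>W\<close> can be given adapted bases built from the same ones. Of
  the adapted basis only its values within each segment are exported, which is what a block
  sees.\<close>

lemma adapted_coordinate_system:
  fixes X :: "(complex, 'v) module" and Vs :: "nat \<Rightarrow> (complex, 'u) module"
  assumes X: "fin_dim_rep G X \<rho>" and dec: "irrep_decomposition G r Vs \<mu> X \<rho> S k"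
    and Vs: "\<And>i. i \<in> {1..r} \<Longrightarrow> coordinate_system (Vs i) {..<d i} (\<beta> i) (\<gamma> i)"
  obtains b co \<iota> \<pi> where
    "coordinate_system X {..<\<Sum>i\<in>S. k i * d i} b co"
    "\<And>p. p \<in> (SIGMA i:S. {1..k i}) \<Longrightarrow> intertwiner G (Vs (fst p)) (\<mu> (fst p)) X \<rho> (\<iota> p)"
    "\<And>p. p \<in> (SIGMA i:S. {1..k i}) \<Longrightarrow> intertwiner G X \<rho> (Vs (fst p)) (\<mu> (fst p)) (\<pi> p)"
    "\<And>i p. i \<in> S \<Longrightarrow> p < k i * d i \<Longrightarrow>
      b ((\<Sum>t | t \<in> S \<and> t < i. k t * d t) + p) = \<iota> (i, p div d i + 1) (\<beta> i (p mod d i))"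
    "\<And>i p v. i \<in> S \<Longrightarrow> p < k i * d i \<Longrightarrow>
      co v ((\<Sum>t | t \<in> S \<and> t < i. k t * d t) + p) = \<gamma> i (\<pi> (i, p div d i + 1) v) (p mod d i)"
proof -
  have S: "S \<subseteq> {1..r}" "finite S"
    using dec finite_subset by (auto simp: irrep_decomposition_def)
  let ?P = "SIGMA i:S. {1..k i}"
  obtain \<iota> \<pi> where \<iota>: "\<And>p. p \<in> ?P \<Longrightarrow> intertwiner G (Vs (fst p)) (\<mu> (fst p)) X \<rho> (\<iota> p)"
    and \<pi>: "\<And>p. p \<in> ?P \<Longrightarrow> intertwiner G X \<rho> (Vs (fst p)) (\<mu> (fst p)) (\<pi> p)"
    and \<pi>_\<iota>: "\<And>p q x. p \<in> ?P \<Longrightarrow> q \<in> ?P \<Longrightarrow> x \<in> carrier (Vs (fst q)) \<Longrightarrow>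
      \<pi> p (\<iota> q x) = (if p = q then x else \<zero>\<^bsub>Vs (fst p)\<^esub>)"
    and sum: "\<And>v. v \<in> carrier X \<Longrightarrow> (\<Oplus>\<^bsub>X\<^esub>p\<in>?P. \<iota> p (\<pi> p v)) = v"
    using irrep_decomposition_biproduct[OF X dec] by blast
  let ?b = "\<lambda>x. \<iota> (fst x) (\<beta> (fst (fst x)) (snd x))"
  let ?co = "\<lambda>v x. \<gamma> (fst (fst x)) (\<pi> (fst x) v) (snd x)"
  let ?dec = "inv_into (position_index S k d) (position S k d)"
  have "coordinate_system X (Sigma ?P (\<lambda>p. {..<d (fst p)})) ?b ?co"
  proof (rule coordinate_system_biproduct[where X = "\<lambda>p. Vs (fst p)"])
    show "finite ?P" using S(2) by simp
    show "coordinate_system (Vs (fst p)) {..<d (fst p)} (\<beta> (fst p)) (\<gamma> (fst p))" if "p \<in> ?P" for p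
      using Vs[of "fst p"] S(1) that by auto
  qed (use fin_dim_repD(1)[OF X] intertwinerD(1)[OF \<iota>] intertwinerD(1)[OF \<pi>] \<pi>_\<iota> sum in blast)+
  then have "coordinate_system X {..<\<Sum>i\<in>S. k i * d i} (\<lambda>x. ?b (?dec x)) (\<lambda>v x. ?co v (?dec x))"
    using bij_betw_inv_into[OF bij_betw_position[OF S(2), of k d]]
    unfolding position_index_def by (rule coordinate_system.reindex)
  then show thesis
    by (rule that[OF _ \<iota> \<pi>]) (simp_all add: position_inverse[OF S(2)])
qed

text \<open>An entry of the block at \<open>j\<close> and \<open>i\<close> is a coordinate of the
  image of a basis vector of \<open>Vs i\<close> under an intertwiner from \<open>Vs i\<close> to
  \<open>Vs j\<close>. Schur's lemma thus evaluates the blocks entry by entry.\<close>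

lemma block_form_of_decompositions:
  fixes V :: "(complex, 'v) module" and W :: "(complex, 'w) module"
    and Vs :: "nat \<Rightarrow> (complex, 'u) module" and \<psi>mat :: "'g \<Rightarrow> complex mat"
  assumes d_def: "d = (\<lambda>i. vectorspace.dim class_ring (Vs i))"
    and V: "fin_dim_rep G V \<rho>V" and W: "fin_dim_rep G W \<rho>W"
    and list: "full_irrep_list G r Vs \<mu>" and filter: "equivariant_filter G V \<rho>V W \<rho>W \<psi>"
    and bV: "ordered_basis V bV" and bW: "ordered_basis W bW"
    and \<psi>mat: "\<And>g. g \<in> carrier G \<Longrightarrow> is_matrix_of bV W bW (\<psi> g) (\<psi>mat g)"
    and decV: "irrep_decomposition G r Vs \<mu> V \<rho>V I m" and decW: "irrep_decomposition G r Vs \<mu> W \<rho>W J n"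
  obtains Qin Qin_inv Qout Qout_inv and A :: "nat \<Rightarrow> 'g \<Rightarrow> complex mat" where
    "Qin \<in> carrier_mat (vectorspace.dim class_ring V) (vectorspace.dim class_ring V)"
    "inverts_mat Qin Qin_inv" "inverts_mat Qin_inv Qin"
    "Qout \<in> carrier_mat (vectorspace.dim class_ring W) (vectorspace.dim class_ring W)"
    "inverts_mat Qout Qout_inv" "inverts_mat Qout_inv Qout"
    "\<And>g. g \<in> carrier G \<Longrightarrow>
      Qout_inv * \<psi>mat g * Qin \<in> carrier_mat (\<Sum>j\<in>J. n j * d j) (\<Sum>i\<in>I. m i * d i)"
    "\<And>g i j. g \<in> carrier G \<Longrightarrow> j \<in> J \<Longrightarrow> i \<in> I \<Longrightarrow> i \<noteq> j \<Longrightarrow>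
      block J (\<lambda>j. n j * d j) I (\<lambda>i. m i * d i) (Qout_inv * \<psi>mat g * Qin) j i = 0\<^sub>m (n j * d j) (m i * d i)"
    "\<And>g i. g \<in> carrier G \<Longrightarrow> A i g \<in> carrier_mat (n i) (m i)"
    "\<And>g i. g \<in> carrier G \<Longrightarrow> i \<in> I \<inter> J \<Longrightarrow>
      block J (\<lambda>j. n j * d j) I (\<lambda>i. m i * d i) (Qout_inv * \<psi>mat g * Qin) i i =
        kronecker_product (A i g) (1\<^sub>m (d i))"
proof -
  have sub: "I \<subseteq> {1..r}" "J \<subseteq> {1..r}" using decV decW by (auto simp: irrep_decomposition_def)
  then have fin: "finite I" "finite J" by (auto intro: finite_subset)
  have irr: "irreducible_rep G (Vs i) (\<mu> i)" if "i \<in> {1..r}" for i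
    using list that by (simp add: full_irrep_list_def)
  have noniso: "\<not> isomorphic_reps G (Vs i) (\<mu> i) (Vs j) (\<mu> j)"
    if "i \<in> {1..r}" "j \<in> {1..r}" "i \<noteq> j" for i j
    using list that by (simp add: full_irrep_list_def)
  have "\<exists>b co. coordinate_system (Vs i) {..<d i} b co" if "i \<in> {1..r}" for i
  proof -
    note rep = fin_dim_repD[OF irreducible_repD(1)[OF irr[OF that]]]
    show ?thesis
      unfolding d_def
      using complex_vectorspace.coordinate_system_exists[OF complex_vectorspaceI[OF rep(1)] rep(2)] .
  qed
  then obtain \<beta> \<gamma> where Vs: "\<And>i. i \<in> {1..r} \<Longrightarrow> coordinate_system (Vs i) {..<d i} (\<beta> i) (\<gamma> i)"
    by metis
  let ?NV = "\<Sum>i\<in>I. m i * d i" and ?NW = "\<Sum>j\<in>J. n j * d j"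
  obtain b co \<iota> where cV: "coordinate_system V {..<?NV} b co"
    and \<iota>: "\<And>p. p \<in> (SIGMA i:I. {1..m i}) \<Longrightarrow> intertwiner G (Vs (fst p)) (\<mu> (fst p)) V \<rho>V (\<iota> p)"
    and b: "\<And>i p. i \<in> I \<Longrightarrow> p < m i * d i \<Longrightarrow>
      b ((\<Sum>t | t \<in> I \<and> t < i. m t * d t) + p) = \<iota> (i, p div d i + 1) (\<beta> i (p mod d i))"
  proof (rule adapted_coordinate_system[OF V decV Vs], goal_cases)
    case (2 b co \<iota> \<pi>)
    show ?case by (rule that[of b co \<iota>]) (use 2 in simp_all)
  qed
  obtain b' co' \<pi> where cW: "coordinate_system W {..<?NW} b' co'"
    and \<pi>: "\<And>p. p \<in> (SIGMA j:J. {1..n j}) \<Longrightarrow> intertwiner G W \<rho>W (Vs (fst p)) (\<mu> (fst p)) (\<pi> p)"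
    and co': "\<And>j p w. j \<in> J \<Longrightarrow> p < n j * d j \<Longrightarrow>
      co' w ((\<Sum>t | t \<in> J \<and> t < j. n t * d t) + p) = \<gamma> j (\<pi> (j, p div d j + 1) w) (p mod d j)"
  proof (rule adapted_coordinate_system[OF W decW Vs], goal_cases)
    case (2 b co \<iota> \<pi>)
    show ?case by (rule that[of b co \<pi>]) (use 2 in simp_all)
  qed
  interpret cV: coordinate_system V "{..<?NV}" b co by (rule cV)
  interpret cW: coordinate_system W "{..<?NW}" b' co' by (rule cW)
  obtain coV where coV: "coordinate_system V {..<length bV} ((!) bV) coV"
    using cV.coordinate_system_of_ordered_basis[OF bV] by blast
  obtain coW where coW: "coordinate_system W {..<length bW} ((!) bW) coW"
    using cW.coordinate_system_of_ordered_basis[OF bW] by blast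
  interpret coV: coordinate_system V "{..<length bV}" "(!) bV" coV by (rule coV)
  interpret coW: coordinate_system W "{..<length bW}" "(!) bW" coW by (rule coW)
  have len: "length bV = ?NV" "length bW = ?NW"
    using cV.dim_eq_card coV.dim_eq_card cW.dim_eq_card coW.dim_eq_card by simp_all
  have filt: "intertwiner G V \<rho>V W \<rho>W (\<psi> g)" if "g \<in> carrier G" for g
    using filter that by (simp add: equivariant_filter_def intertwiner_def)
  note id_V = linear_map_id[OF cV.vectorspace_axioms] and id_W = linear_map_id[OF cW.vectorspace_axioms]
  \<comment> \<open>\<open>Qin\<close> and \<open>Qout\<close> turn adapted coordinates into
    coordinates in the given bases; the matrices with suffix \<open>_inv\<close> go back.\<close>
  define Qin where "Qin = coordinate_matrix ?NV ?NV coV b"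
  define Qin_inv where "Qin_inv = coordinate_matrix ?NV ?NV co ((!) bV)"
  define Qout where "Qout = coordinate_matrix ?NW ?NW coW b'"
  define Qout_inv where "Qout_inv = coordinate_matrix ?NW ?NW co' ((!) bW)"
  \<comment> \<open>The entry is the scalar from Schur's lemma for a pair of copies. Row and column
    numbers start at 0 and copies at 1, hence \<open>l + 1\<close> and \<open>k + 1\<close>. Where
    no such scalar exists the choice is arbitrary and only the size of the matrix matters.\<close>
  define A where "A i g = mat (n i) (m i) (\<lambda>(l, k). SOME a. \<forall>x\<in>carrier (Vs i).
    \<pi> (i, l + 1) (\<psi> g (\<iota> (i, k + 1) x)) = a \<odot>\<^bsub>Vs i\<^esub> x)" for i g
  have Q: "Qin * Qin_inv = 1\<^sub>m ?NV" "Qin_inv * Qin = 1\<^sub>m ?NV"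
    "Qout * Qout_inv = 1\<^sub>m ?NW" "Qout_inv * Qout = 1\<^sub>m ?NW"
    unfolding Qin_def Qin_inv_def Qout_def Qout_inv_def
    using coordinate_matrix_mult[OF cV coV[unfolded len] id_V, of ?NV "(!) bV"]
      coordinate_matrix_mult[OF coV[unfolded len] cV id_V, of ?NV b]
      coordinate_matrix_mult[OF cW coW[unfolded len] id_W, of ?NW "(!) bW"]
      coordinate_matrix_mult[OF coW[unfolded len] cW id_W, of ?NW b']
      coordinate_matrix_basis[OF coV] coordinate_matrix_basis[OF cV]
      coordinate_matrix_basis[OF coW] coordinate_matrix_basis[OF cW]
    by (simp_all add: len)
  \<comment> \<open>The given bases cancel, leaving the matrix of \<open>\<psi> g\<close> in the
    adapted bases.\<close>
  have \<kappa>: "Qout_inv * \<psi>mat g * Qin = coordinate_matrix ?NW ?NV co' (\<lambda>q. \<psi> g (b q))"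
    if g: "g \<in> carrier G" for g
  proof -
    note lin = intertwinerD(1)[OF filt[OF g]]
    have M: "\<psi>mat g = coordinate_matrix ?NW ?NV coW (\<lambda>j. \<psi> g (bV ! j))"
      using is_matrix_of_coordinate_matrix[OF coW \<psi>mat[OF g]] by (simp add: len)
    have "Qout_inv * \<psi>mat g = coordinate_matrix ?NW ?NV co' (\<lambda>j. \<psi> g (bV ! j))"
      unfolding Qout_inv_def M
      using coordinate_matrix_mult[OF coW[unfolded len] cW id_W, of ?NV "\<lambda>j. \<psi> g (bV ! j)"]
        linear_mapD(3)[OF lin] coV.basis_in by (simp add: len)
    then show ?thesis
      using coordinate_matrix_mult[OF coV[unfolded len] cW lin, of ?NV b] by (simp add: Qin_def)
  qed
  have entry: "block J (\<lambda>j. n j * d j) I (\<lambda>i. m i * d i) (Qout_inv * \<psi>mat g * Qin) j i =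
      mat (n j * d j) (m i * d i) (\<lambda>(p, q).
        \<gamma> j (\<pi> (j, p div d j + 1) (\<psi> g (\<iota> (i, q div d i + 1) (\<beta> i (q mod d i))))) (p mod d j))"
    if "g \<in> carrier G" "i \<in> I" "j \<in> J" for g i j
  proof -
    have off: "(\<Sum>t | t \<in> S \<and> t < s. len t) + p < (\<Sum>t\<in>S. len t)" if "finite S" "s \<in> S" "p < len s"
      for S s p and len :: "nat \<Rightarrow> nat"
      using offset_bound[OF that(1,2), of len] that(3) by linarith
    show ?thesis
      using that fin
      by (subst block_eq)
        (auto simp: \<kappa> coordinate_matrix_def off b co' intro!: cong_mat)
  qed
  \<comment> \<open>Each entry involves one copy in \<open>V\<close> and one in \<open>W\<close>,
    selected by the quotients of its column and row.\<close>
  have inter: "intertwiner G (Vs i) (\<mu> i) (Vs j) (\<mu> j) (\<lambda>x. \<pi> (j, p div d j + 1) (\<psi> g (\<iota> (i, q div d i + 1) x)))"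
    if "g \<in> carrier G" "i \<in> I" "j \<in> J" "p < n j * d j" "q < m i * d i" for g i j p q
  proof -
    have "p div d j < n j" "q div d i < m i" using that by (simp_all add: less_mult_imp_div_less)
    then show ?thesis
      using that intertwiner_comp[OF intertwiner_comp[OF \<iota> filt] \<pi>, of "(i, q div d i + 1)" g "(j, p div d j + 1)"]
      by simp
  qed
  show thesis
  proof (rule that[of Qin Qin_inv Qout Qout_inv A])
    show "Qin \<in> carrier_mat cV.dim cV.dim" "Qout \<in> carrier_mat cW.dim cW.dim"
      by (simp_all add: cV.dim_eq_card cW.dim_eq_card Qin_def Qout_def)
    show "inverts_mat Qin Qin_inv" "inverts_mat Qin_inv Qin"
      "inverts_mat Qout Qout_inv" "inverts_mat Qout_inv Qout"
      using Q by (simp_all add: inverts_mat_def Qin_def Qin_inv_def Qout_def Qout_inv_def coordinate_matrix_def)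
    show "Qout_inv * \<psi>mat g * Qin \<in> carrier_mat ?NW ?NV" if "g \<in> carrier G" for g
      by (simp add: \<kappa> that)
    show "A i g \<in> carrier_mat (n i) (m i)" for i g by (simp add: A_def)
    fix g i j assume g: "g \<in> carrier G" and j: "j \<in> J" and i: "i \<in> I" and ij: "i \<noteq> j"
    have r: "i \<in> {1..r}" "j \<in> {1..r}" using i j sub by auto
    interpret Vi: coordinate_system "Vs i" "{..<d i}" "\<beta> i" "\<gamma> i" by (rule Vs[OF r(1)])
    interpret Vj: coordinate_system "Vs j" "{..<d j}" "\<beta> j" "\<gamma> j" by (rule Vs[OF r(2)])
    show "block J (\<lambda>j. n j * d j) I (\<lambda>i. m i * d i) (Qout_inv * \<psi>mat g * Qin) j i =
        0\<^sub>m (n j * d j) (m i * d i)"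
      unfolding entry[OF g i j]
    proof (rule eq_matI, goal_cases)
      case (1 p q)
      then have pq: "p < n j * d j" "q < m i * d i" by simp_all
      \<comment> \<open>An index below a product with factor \<open>d j\<close> or
        \<open>d i\<close> rules out that the factor is zero, so the remainders are proper basis
        indices.\<close>
      then have mods: "p mod d j < d j" "q mod d i < d i" by (auto intro!: mod_less_divisor gr0I)
      show ?case
        using pq mods schur_zero[OF irr[OF r(1)] irr[OF r(2)] inter[OF g i j pq] noniso[OF r ij]]
        by (simp add: Vj.co_zero)
    qed simp_all
  next
    fix g i assume g: "g \<in> carrier G" and "i \<in> I \<inter> J"
    then have i: "i \<in> I" "i \<in> J" and r: "i \<in> {1..r}" using sub by auto
    interpret Vi: coordinate_system "Vs i" "{..<d i}" "\<beta> i" "\<gamma> i" by (rule Vs[OF r])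
    show "block J (\<lambda>j. n j * d j) I (\<lambda>i. m i * d i) (Qout_inv * \<psi>mat g * Qin) i i =
        kronecker_product (A i g) (1\<^sub>m (d i))"
      unfolding entry[OF g i]
    proof (rule eq_matI, goal_cases)
      case (1 p q)
      then have pq: "p < n i * d i" "q < m i * d i" by (simp_all add: kronecker_product_def A_def)
      then have mods: "p mod d i < d i" "q mod d i < d i" by (auto intro!: mod_less_divisor gr0I)
      have divs: "p div d i < n i" "q div d i < m i" using pq by (simp_all add: less_mult_imp_div_less)
      let ?T = "\<lambda>x. \<pi> (i, p div d i + 1) (\<psi> g (\<iota> (i, q div d i + 1) x))"
      have "\<forall>x\<in>carrier (Vs i). ?T x = A i g $$ (p div d i, q div d i) \<odot>\<^bsub>Vs i\<^esub> x"
        using someI_ex[OF schur_scalar[OF irr[OF r] inter[OF g i pq]]] divs by (simp add: A_def)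
      \<comment> \<open>The two sides use the same basis, so the scalar map contributes a Kronecker
        delta in the remainders: the entry of the identity factor.\<close>
      then have "\<gamma> i (?T (\<beta> i (q mod d i))) (p mod d i) =
          A i g $$ (p div d i, q div d i) * (if q mod d i = p mod d i then 1 else 0)"
        using mods by (simp add: Vi.co_smult Vi.co_basis)
      then show ?case
        using pq mods by (simp add: kronecker_product_def A_def)
    qed (simp_all add: kronecker_product_def A_def)
  qed
qed

text \<open>The two existence clauses keep the universal clause from being vacuous. In the latter
  the change-of-basis matrices are chosen before \<open>g\<close>, so one pair of adapted bases
  serves the whole group.\<close>

theorem theorem3p2:
  fixes G :: "('g, 'x) monoid_scheme"
    and V :: "(complex, 'v) module" and \<rho>V :: "'g \<Rightarrow> 'v \<Rightarrow> 'v" and bV :: "'v list"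
    and W :: "(complex, 'w) module" and \<rho>W :: "'g \<Rightarrow> 'w \<Rightarrow> 'w" and bW :: "'w list"
    and r :: nat and Vs :: "nat \<Rightarrow> (complex, 'u) module" and \<mu> :: "nat \<Rightarrow> 'g \<Rightarrow> 'u \<Rightarrow> 'u"
    and \<psi> :: "'g \<Rightarrow> 'v \<Rightarrow> 'w" and \<psi>mat :: "'g \<Rightarrow> complex mat"
  defines "dimV \<equiv> vectorspace.dim class_ring V"
    and "dimW \<equiv> vectorspace.dim class_ring W"
    and "d \<equiv> (\<lambda>i. vectorspace.dim class_ring (Vs i))"
  assumes "group G" and "finite (carrier G)"
    and "fin_dim_rep G V \<rho>V" and "fin_dim_rep G W \<rho>W"
    and "full_irrep_list G r Vs \<mu>"
    and "equivariant_filter G V \<rho>V W \<rho>W \<psi>"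
    and "ordered_basis V bV" and "ordered_basis W bW"
    and "\<forall>g\<in>carrier G. is_matrix_of bV W bW (\<psi> g) (\<psi>mat g)"
  shows "(\<exists>I m. irrep_decomposition G r Vs \<mu> V \<rho>V I m) \<and>
    (\<exists>J n. irrep_decomposition G r Vs \<mu> W \<rho>W J n) \<and>
    (\<forall>I m J n. irrep_decomposition G r Vs \<mu> V \<rho>V I m \<and> irrep_decomposition G r Vs \<mu> W \<rho>W J n \<longrightarrow>
      (\<exists>Qin Qout Qout_inv. \<exists>A :: nat \<Rightarrow> 'g \<Rightarrow> complex mat.
        Qin \<in> carrier_mat dimV dimV \<and> invertible_mat Qin \<and>
        Qout \<in> carrier_mat dimW dimW \<and> invertible_mat Qout \<and>
        inverts_mat Qout Qout_inv \<and> inverts_mat Qout_inv Qout \<and>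
        (\<forall>g\<in>carrier G.
          let \<kappa> = Qout_inv * \<psi>mat g * Qin;
              \<kappa>_block = block J (\<lambda>j. n j * d j) I (\<lambda>i. m i * d i) \<kappa>
          in \<kappa> \<in> carrier_mat (\<Sum>j\<in>J. n j * d j) (\<Sum>i\<in>I. m i * d i) \<and>
             (\<forall>j\<in>J. \<forall>i\<in>I. i \<noteq> j \<longrightarrow> \<kappa>_block j i = 0\<^sub>m (n j * d j) (m i * d i)) \<and>
             (\<forall>i\<in>I \<inter> J. 0 < d i \<and> A i g \<in> carrier_mat (n i) (m i) \<and>
                \<kappa>_block i i = kronecker_product (A i g) (1\<^sub>m (d i))))))"
proof (intro conjI allI impI)
  note facts = assms(4-)
  show "\<exists>I m. irrep_decomposition G r Vs \<mu> V \<rho>V I m" "\<exists>J n. irrep_decomposition G r Vs \<mu> W \<rho>W J n"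
    using irrep_decomposition_exists facts(1-5) by blast+
  fix I m J n
  assume dec: "irrep_decomposition G r Vs \<mu> V \<rho>V I m \<and> irrep_decomposition G r Vs \<mu> W \<rho>W J n"
  \<comment> \<open>Irreducible representations are nonzero by definition, so the identity factors
    have positive size.\<close>
  have d: "0 < d i" if "i \<in> I" for i
  proof -
    have "irreducible_rep G (Vs i) (\<mu> i)"
      using dec facts(5) that by (auto simp: irrep_decomposition_def full_irrep_list_def)
    then show ?thesis unfolding d_def by (rule irreducible_rep_dim_pos)
  qed
  show "\<exists>Qin Qout Qout_inv. \<exists>A :: nat \<Rightarrow> 'g \<Rightarrow> complex mat.
      Qin \<in> carrier_mat dimV dimV \<and> invertible_mat Qin \<and>
      Qout \<in> carrier_mat dimW dimW \<and> invertible_mat Qout \<and>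
      inverts_mat Qout Qout_inv \<and> inverts_mat Qout_inv Qout \<and>
      (\<forall>g\<in>carrier G.
        let \<kappa> = Qout_inv * \<psi>mat g * Qin;
            \<kappa>_block = block J (\<lambda>j. n j * d j) I (\<lambda>i. m i * d i) \<kappa>
        in \<kappa> \<in> carrier_mat (\<Sum>j\<in>J. n j * d j) (\<Sum>i\<in>I. m i * d i) \<and>
           (\<forall>j\<in>J. \<forall>i\<in>I. i \<noteq> j \<longrightarrow> \<kappa>_block j i = 0\<^sub>m (n j * d j) (m i * d i)) \<and>
           (\<forall>i\<in>I \<inter> J. 0 < d i \<and> A i g \<in> carrier_mat (n i) (m i) \<and>
              \<kappa>_block i i = kronecker_product (A i g) (1\<^sub>m (d i))))"
  proof (rule block_form_of_decompositions[OF meta_eq_to_obj_eq[OF d_def] facts(3-8),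
        of \<psi>mat I m J n, folded dimV_def dimW_def], goal_cases)
    case (4 Qin Qin_inv Qout Qout_inv A)
    then show ?case
      using d unfolding Let_def
      by - (rule exI[where x = Qin], rule exI[where x = Qout], rule exI[where x = Qout_inv],
          rule exI[where x = A], auto simp: invertible_mat_def)
  qed (use facts(9) dec in blast)+
qed

end
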